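(* Let $T$ be a finite tree of order at least $3$. Then $D'(T) = D(T)+1$ if $T \in \mathcal{T}$, and $D'(T) = D(T)$ otherwise.
   Context: For a graph $G$, a vertex labeling $\phi: V(G)\to\{1,\dots,r\}$ is distinguishing if the only automorphism of $G$ preserving all labels (i.e. $\phi(\alpha(x))=\phi(x)$ for all $x$) is the identity. The distinguishing number $D(G)$ is the least $r$ for which a distinguishing vertex labeling with labels $\{1,\dots,r\}$ exists. Analogously, an edge labeling is distinguishing if the only automorphism of $G$ preserving it is the identity, and the distinguishing index $D'(G)$ is the least number of labels in a distinguishing edge labeling. The center of a tree is the subgraph induced by its vertices of minimum eccentricity; a tree is bicentric if its center consists of two (adjacent) vertices $v,w$, and then $e=vw$ is called the central edge. For a bicentric tree with central edge $vw$, $T_v$ and $T_w$ denote the components of $T-vw$ containing $v$ and $w$ respectively, regarded as rooted trees with roots $v$ and $w$. An automorphism of a rooted tree is an automorphism of the underlying tree fixing the root; an isomorphism of rooted trees is a tree isomorphism mapping root to root; an edge labeling of a rooted tree is distinguishing if the only rooted-tree automorphism preserving it is the identity. Two edge labelings $g,g''$ of a rooted tree are regarded as the same (isomorphic) if $g'' = g\circ\alpha$ for some automorphism $\alpha$ of the rooted tree. $\mathcal{T}$ is the family of trees $T$ of order at least $3$ such that: (1) $T$ is bicentric with central edge $vw$; (2) the rooted trees $T_v$ and $T_w$ are isomorphic (as rooted trees); (3) up to isomorphism there is a unique distinguishing edge labeling of the rooted tree $T_v$ with labels from $\{1,\dots,D(T)\}$. *)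

theory Defs
  imports Main
begin

section \<open>Undirected graphs\<close>

record 'a ugraph =
  vertices :: "'a set"
  edges :: "'a set set"

definition simple_graph :: "'a ugraph \<Rightarrow> bool" where
  "simple_graph G \<longleftrightarrow> finite (vertices G) \<and> (\<forall>e\<in>edges G. e \<subseteq> vertices G \<and> card e = 2)"

definition adjacent :: "'a ugraph \<Rightarrow> 'a \<Rightarrow> 'a \<Rightarrow> bool" where
  "adjacent G x y \<longleftrightarrow> {x, y} \<in> edges G"

text \<open>Walks are nonempty vertex lists, so a list of length $n + 1$ is a walk with $n$ edges.\<close>

definition walk :: "'a ugraph \<Rightarrow> 'a \<Rightarrow> 'a list \<Rightarrow> 'a \<Rightarrow> bool" where
  "walk G x p y \<longleftrightarrow> p \<noteq> [] \<and> hd p = x \<and> last p = y \<and> set p \<subseteq> vertices G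
     \<and> successively (adjacent G) p"

definition connected_graph :: "'a ugraph \<Rightarrow> bool" where
  "connected_graph G \<longleftrightarrow> vertices G \<noteq> {} \<and> (\<forall>x\<in>vertices G. \<forall>y\<in>vertices G. \<exists>p. walk G x p y)"

definition cycle_in :: "'a ugraph \<Rightarrow> 'a list \<Rightarrow> bool" where
  "cycle_in G p \<longleftrightarrow> 3 \<le> length p \<and> distinct p \<and> walk G (hd p) p (last p)
     \<and> adjacent G (last p) (hd p)"

definition finite_tree :: "'a ugraph \<Rightarrow> bool" where
  "finite_tree G \<longleftrightarrow> simple_graph G \<and> connected_graph G \<and> (\<nexists>p. cycle_in G p)"

definition induced_subgraph :: "'a ugraph \<Rightarrow> 'a set \<Rightarrow> 'a ugraph" where
  "induced_subgraph G S =
     \<lparr>vertices = vertices G \<inter> S, edges = {e \<in> edges G. e \<subseteq> S}\<rparr>"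

definition delete_edge :: "'a ugraph \<Rightarrow> 'a set \<Rightarrow> 'a ugraph" where
  "delete_edge G e = \<lparr>vertices = vertices G, edges = edges G - {e}\<rparr>"

definition component_of :: "'a ugraph \<Rightarrow> 'a \<Rightarrow> 'a ugraph" where
  "component_of G v = induced_subgraph G {x. \<exists>p. walk G v p x}"

section \<open>Center of a graph\<close>

text \<open>Distance and eccentricity are meaningful for finite connected graphs only.\<close>

definition graph_dist :: "'a ugraph \<Rightarrow> 'a \<Rightarrow> 'a \<Rightarrow> nat" where
  "graph_dist G x y = (LEAST n. \<exists>p. walk G x p y \<and> length p = n + 1)"

definition eccentricity :: "'a ugraph \<Rightarrow> 'a \<Rightarrow> nat" where
  "eccentricity G x = Max (graph_dist G x ` vertices G)"

definition center :: "'a ugraph \<Rightarrow> 'a ugraph" where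
  "center G = induced_subgraph G
     {x \<in> vertices G. \<forall>y\<in>vertices G. eccentricity G x \<le> eccentricity G y}"

definition bicentric_with :: "'a ugraph \<Rightarrow> 'a \<Rightarrow> 'a \<Rightarrow> bool" where
  "bicentric_with T v w \<longleftrightarrow> v \<noteq> w \<and> center T = \<lparr>vertices = {v, w}, edges = {{v, w}}\<rparr>"

section \<open>Isomorphisms, automorphisms and distinguishing labelings\<close>

text \<open>
  Isomorphisms are functions on the whole type of which only the values on the vertex set matter.
  Accordingly, an automorphism counts as the identity if it fixes every vertex of the graph, and
  labelings matter only on the vertices or edges of the graph.
\<close>

definition graph_iso :: "'a ugraph \<Rightarrow> 'b ugraph \<Rightarrow> ('a \<Rightarrow> 'b) \<Rightarrow> bool" where
  "graph_iso G H f \<longleftrightarrow> bij_betw f (vertices G) (vertices H)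
     \<and> (\<forall>x\<in>vertices G. \<forall>y\<in>vertices G. adjacent G x y \<longleftrightarrow> adjacent H (f x) (f y))"

definition graph_aut :: "'a ugraph \<Rightarrow> ('a \<Rightarrow> 'a) \<Rightarrow> bool" where
  "graph_aut G f \<longleftrightarrow> graph_iso G G f"

definition rooted_isomorphic :: "'a ugraph \<Rightarrow> 'a \<Rightarrow> 'b ugraph \<Rightarrow> 'b \<Rightarrow> bool" where
  "rooted_isomorphic G x H y \<longleftrightarrow> (\<exists>f. graph_iso G H f \<and> f x = y)"

definition rooted_aut :: "'a ugraph \<Rightarrow> 'a \<Rightarrow> ('a \<Rightarrow> 'a) \<Rightarrow> bool" where
  "rooted_aut G x f \<longleftrightarrow> graph_aut G f \<and> f x = x"

definition distinguishing_vertex_labeling :: "'a ugraph \<Rightarrow> nat \<Rightarrow> ('a \<Rightarrow> nat) \<Rightarrow> bool" where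
  "distinguishing_vertex_labeling G r \<phi> \<longleftrightarrow> \<phi> ` vertices G \<subseteq> {1..r}
     \<and> (\<forall>\<alpha>. graph_aut G \<alpha> \<and> (\<forall>x\<in>vertices G. \<phi> (\<alpha> x) = \<phi> x) \<longrightarrow> (\<forall>x\<in>vertices G. \<alpha> x = x))"

definition distinguishing_number :: "'a ugraph \<Rightarrow> nat" where
  "distinguishing_number G = (LEAST r. \<exists>\<phi>. distinguishing_vertex_labeling G r \<phi>)"

definition distinguishing_edge_labeling :: "'a ugraph \<Rightarrow> nat \<Rightarrow> ('a set \<Rightarrow> nat) \<Rightarrow> bool" where
  "distinguishing_edge_labeling G r g \<longleftrightarrow> g ` edges G \<subseteq> {1..r}
     \<and> (\<forall>\<alpha>. graph_aut G \<alpha> \<and> (\<forall>e\<in>edges G. g (\<alpha> ` e) = g e) \<longrightarrow> (\<forall>x\<in>vertices G. \<alpha> x = x))"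

text \<open>
  A graph with a nontrivial automorphism inducing the identity on edges, such as $K_2$, has no
  distinguishing edge labeling; the value below is then unspecified.
\<close>

definition distinguishing_index :: "'a ugraph \<Rightarrow> nat" where
  "distinguishing_index G = (LEAST r. \<exists>g. distinguishing_edge_labeling G r g)"

definition rooted_distinguishing_edge_labeling ::
    "'a ugraph \<Rightarrow> 'a \<Rightarrow> nat \<Rightarrow> ('a set \<Rightarrow> nat) \<Rightarrow> bool" where
  "rooted_distinguishing_edge_labeling G x r g \<longleftrightarrow> g ` edges G \<subseteq> {1..r}
     \<and> (\<forall>\<alpha>. rooted_aut G x \<alpha> \<and> (\<forall>e\<in>edges G. g (\<alpha> ` e) = g e) \<longrightarrow> (\<forall>y\<in>vertices G. \<alpha> y = y))"

definition rooted_edge_labelings_isomorphic ::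
    "'a ugraph \<Rightarrow> 'a \<Rightarrow> ('a set \<Rightarrow> nat) \<Rightarrow> ('a set \<Rightarrow> nat) \<Rightarrow> bool" where
  "rooted_edge_labelings_isomorphic G x g g' \<longleftrightarrow>
     (\<exists>\<alpha>. rooted_aut G x \<alpha> \<and> (\<forall>e\<in>edges G. g' e = g (\<alpha> ` e)))"

definition unique_rooted_distinguishing_edge_labeling :: "'a ugraph \<Rightarrow> 'a \<Rightarrow> nat \<Rightarrow> bool" where
  "unique_rooted_distinguishing_edge_labeling G x r \<longleftrightarrow>
     (\<exists>g. rooted_distinguishing_edge_labeling G x r g
        \<and> (\<forall>g'. rooted_distinguishing_edge_labeling G x r g'
              \<longrightarrow> rooted_edge_labelings_isomorphic G x g g'))"

section \<open>The exceptional family of trees\<close>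

definition half_tree :: "'a ugraph \<Rightarrow> 'a \<Rightarrow> 'a \<Rightarrow> 'a ugraph" where
  "half_tree T v w = component_of (delete_edge T {v, w}) v"

definition exceptional_trees :: "'a ugraph set" where
  "exceptional_trees = {T. finite_tree T \<and> card (vertices T) \<ge> 3
     \<and> (\<exists>v w. bicentric_with T v w
          \<and> rooted_isomorphic (half_tree T v w) v (half_tree T w v) w
          \<and> unique_rooted_distinguishing_edge_labeling (half_tree T v w) v
              (distinguishing_number T))}"

end

theory Submission
  imports Defs
begin

text \<open>
  In a rooted tree the non-root vertices correspond to the edges towards their parents, equivariantly
  under rooted automorphisms. Hence \<open>D(T) = D'(T)\<close> as soon as some vertex is fixed by all
  automorphisms. The center is preserved by automorphisms and is a vertex or an edge, so the only
  remaining case is a central edge \<open>vw\<close> whose ends are swapped. There, let \<open>N(k)\<close> be the number of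
  isomorphism classes of distinguishing \<open>k\<close>-edge-labelings of \<open>T\<^sub>v\<close>. A distinguishing labeling of \<open>T\<close>
  amounts to two non-isomorphic ones of the half, so that \<open>T\<close> has a distinguishing
  \<open>k\<close>-edge-labeling iff \<open>N(k) \<ge> 2\<close>; for vertices the label of the root can be used as well, and the
  condition is \<open>k N(k) \<ge> 2\<close>, that is, \<open>k \<ge> 2\<close> and \<open>N(k) \<ge> 1\<close>. Finally \<open>N(k) \<ge> 1\<close> implies
  \<open>N(k + 1) \<ge> 2\<close> by relabeling some edges with the new label.
\<close>

section \<open>Walks and distances\<close>

abbreviation reach :: "'a ugraph \<Rightarrow> 'a \<Rightarrow> 'a \<Rightarrow> bool" where
  "reach G \<equiv> (adjacent G)\<^sup>*\<^sup>*"

lemma adjacent_sym: "adjacent G x y \<Longrightarrow> adjacent G y x"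
  by (simp add: adjacent_def insert_commute)

lemma adjacent_commute: "adjacent G x y \<longleftrightarrow> adjacent G y x"
  by (simp add: adjacent_def insert_commute)

lemma reach_sym: "reach G x y \<Longrightarrow> reach G y x"
  by (metis adjacent_sym sympD sympI symp_rtranclp)

lemma simple_graph_adjacentD:
  assumes "simple_graph G" "adjacent G x y"
  shows "x \<in> vertices G" "y \<in> vertices G" "x \<noteq> y"
  using assms unfolding simple_graph_def adjacent_def by (auto dest: bspec)

lemma simple_graph_edgeE:
  assumes "simple_graph G" "e \<in> edges G"
  obtains x y where "e = {x, y}" "x \<noteq> y" "x \<in> vertices G" "y \<in> vertices G" "adjacent G x y"
proof -
  have "card e = 2" "e \<subseteq> vertices G"
    using assms by (auto simp: simple_graph_def)
  then obtain x y where "e = {x, y}" "x \<noteq> y"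
    by (meson card_2_iff)
  then show thesis
    using that[of x y] \<open>e \<subseteq> vertices G\<close> assms(2) by (auto simp: adjacent_def)
qed

lemma walk_snoc:
  assumes "walk G x p y" "adjacent G y z" "z \<in> vertices G"
  shows "walk G x (p @ [z]) z"
  using assms unfolding walk_def by (auto simp: successively_append_iff)

lemma walk_take:
  assumes "walk G x (p @ z # q) y"
  shows "walk G x (p @ [z]) z"
  using assms unfolding walk_def by (auto simp: successively_append_iff successively_Cons hd_append)

lemma walk_imp_relpowp:
  "walk G x p y \<Longrightarrow> (adjacent G ^^ (length p - 1)) x y"
proof (induction p arbitrary: x)
  case Nil
  then show ?case by (simp add: walk_def)
next
  case (Cons a p)
  show ?case
  proof (cases p)
    case Nil
    then show ?thesis using Cons.prems by (auto simp: walk_def)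
  next
    case (Cons b q)
    have "walk G b p y" "adjacent G x b"
      using Cons.prems Cons by (auto simp: walk_def)
    then have "(adjacent G ^^ Suc (length p - 1)) x y"
      using Cons.IH relpowp_Suc_I2 by metis
    then show ?thesis using Cons by simp
  qed
qed

lemma relpowp_imp_walk:
  assumes "simple_graph G" "x \<in> vertices G" "(adjacent G ^^ n) x y"
  shows "\<exists>p. walk G x p y \<and> length p = n + 1"
  using assms(3)
proof (induction n arbitrary: y)
  case 0
  then show ?case using assms(2) by (intro exI[of _ "[x]"]) (simp add: walk_def)
next
  case (Suc n)
  from Suc.prems obtain z where z: "(adjacent G ^^ n) x z" "adjacent G z y"
    by (auto elim: relpowp_Suc_E)
  from Suc.IH[OF z(1)] obtain p where "walk G x p z" "length p = n + 1"
    by auto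
  with z(2) show ?case
    using walk_snoc[of G x p z y] simple_graph_adjacentD[OF assms(1) z(2)] by fastforce
qed

lemma walk_iff_relpowp:
  assumes "simple_graph G" "x \<in> vertices G"
  shows "(\<exists>p. walk G x p y \<and> length p = n + 1) \<longleftrightarrow> (adjacent G ^^ n) x y"
  using relpowp_imp_walk[OF assms] walk_imp_relpowp by fastforce

lemma walk_iff_reach:
  assumes "simple_graph G" "x \<in> vertices G"
  shows "(\<exists>p. walk G x p y) \<longleftrightarrow> reach G x y"
  using relpowp_imp_walk[OF assms] walk_imp_relpowp by (metis rtranclp_power)

text \<open>\<open>cycle_in\<close> asks for distinct vertices. The walk grows by one vertex at a
  time and is cut back to the earlier occurrence whenever the new vertex already lies on it.\<close>

lemma reach_imp_distinct_walk:
  assumes "simple_graph G" "x \<in> vertices G" "reach G x y"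
  shows "\<exists>p. walk G x p y \<and> distinct p"
  using assms(3)
proof (induction rule: rtranclp_induct)
  case base
  then show ?case using assms(2) by (intro exI[of _ "[x]"]) (simp add: walk_def)
next
  case (step y z)
  then obtain p where p: "walk G x p y" "distinct p" by auto
  show ?case
  proof (cases "z \<in> set p")
    case True
    then obtain q s where "p = q @ z # s" by (meson split_list)
    then show ?thesis using p walk_take[of G x q z s y] by (intro exI[of _ "q @ [z]"]) auto
  next
    case False
    then show ?thesis
      using p walk_snoc[OF p(1) step.hyps(2)] simple_graph_adjacentD[OF assms(1) step.hyps(2)]
      by (intro exI[of _ "p @ [z]"]) auto
  qed
qed

text \<open>With relational powers, distances can be handled without naming the underlying vertex
  lists.\<close>

lemma graph_dist_relpowp:
  assumes "simple_graph G" "x \<in> vertices G"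
  shows "graph_dist G x y = (LEAST n. (adjacent G ^^ n) x y)"
  unfolding graph_dist_def walk_iff_relpowp[OF assms] ..

lemma finite_tree_simple: "finite_tree G \<Longrightarrow> simple_graph G"
  by (simp add: finite_tree_def)

lemma finite_tree_reach:
  assumes "finite_tree G" "x \<in> vertices G" "y \<in> vertices G"
  shows "reach G x y"
  using assms walk_iff_reach[of G x y] by (auto simp: finite_tree_def connected_graph_def)

lemma finite_treeI:
  assumes "simple_graph G" "vertices G \<noteq> {}"
    and "\<And>x y. x \<in> vertices G \<Longrightarrow> y \<in> vertices G \<Longrightarrow> reach G x y"
    and "\<And>p. \<not> cycle_in G p"
  shows "finite_tree G"
  using assms walk_iff_reach[of G] by (auto simp: finite_tree_def connected_graph_def)

section \<open>Distances from a fixed vertex of a tree\<close>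

locale tree =
  fixes G :: "'a ugraph"
  assumes tree: "finite_tree G"
begin

abbreviation d :: "'a \<Rightarrow> 'a \<Rightarrow> nat" where "d \<equiv> graph_dist G"

lemma simple: "simple_graph G"
  using tree by (rule finite_tree_simple)

lemmas adjD = simple_graph_adjacentD[OF simple]

lemma relpowp_dist:
  assumes "x \<in> vertices G" "y \<in> vertices G"
  shows "(adjacent G ^^ d x y) x y"
proof -
  have "\<exists>n. (adjacent G ^^ n) x y"
    using finite_tree_reach[OF tree assms] by (simp add: rtranclp_power)
  then show ?thesis
    unfolding graph_dist_relpowp[OF simple assms(1)] by (rule LeastI_ex)
qed

lemma dist_le:
  assumes "x \<in> vertices G" "(adjacent G ^^ n) x y"
  shows "d x y \<le> n"
  unfolding graph_dist_relpowp[OF simple assms(1)] using assms(2) by (rule Least_le)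

lemma dist_self: "x \<in> vertices G \<Longrightarrow> d x x = 0"
  using dist_le[of x 0 x] by simp

lemma dist_eq_0:
  assumes "x \<in> vertices G" "y \<in> vertices G" "d x y = 0"
  shows "x = y"
  using relpowp_dist[OF assms(1,2)] assms(3) by simp

lemma dist_adj:
  assumes "u \<in> vertices G" "adjacent G a b"
  shows "d u b \<le> Suc (d u a)"
  using relpowp_dist[OF assms(1) adjD(1)[OF assms(2)]] assms(2) dist_le[OF assms(1)]
  by (metis relpowp_Suc_I)

lemma closer_neighbour:
  assumes "u \<in> vertices G" "y \<in> vertices G" "u \<noteq> y"
  obtains z where "adjacent G z y" "d u y = Suc (d u z)"
proof -
  obtain m where m: "d u y = Suc m"
    using dist_eq_0[OF assms(1,2)] assms(3) by (cases "d u y") auto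
  then obtain z where z: "(adjacent G ^^ m) u z" "adjacent G z y"
    using relpowp_dist[OF assms(1,2)] by (auto elim: relpowp_Suc_E)
  have "d u z \<le> m" using dist_le[OF assms(1) z(1)] .
  moreover have "d u y \<le> Suc (d u z)" using dist_adj[OF assms(1) z(2)] .
  ultimately show thesis using that z(2) m by simp
qed

text \<open>A path from \<open>a\<close> to \<open>b\<close> that survives the deletion would close
  up with the edge \<open>ab\<close> to a cycle.\<close>

lemma bridge:
  assumes "adjacent G a b"
  shows "\<not> reach (delete_edge G {a, b}) a b"
proof
  assume r: "reach (delete_edge G {a, b}) a b"
  have s: "simple_graph (delete_edge G {a, b})"
    using simple by (auto simp: simple_graph_def delete_edge_def)
  obtain p where p: "walk (delete_edge G {a, b}) a p b" "distinct p"
    using reach_imp_distinct_walk[OF s _ r] adjD(1)[OF assms] by (auto simp: delete_edge_def)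
  have imp: "adjacent (delete_edge G {a, b}) x y \<Longrightarrow> adjacent G x y" for x y
    by (simp add: adjacent_def delete_edge_def)
  have "walk G a p b"
    using p(1) unfolding walk_def
    by (auto intro: successively_mono[OF _ imp] simp: delete_edge_def)
  \<comment> \<open>One vertex would mean \<open>a = b\<close>, and two vertices would use the
    deleted edge.\<close>
  moreover have "3 \<le> length p"
  proof (rule ccontr)
    assume "\<not> 3 \<le> length p"
    then consider "p = []" | x where "p = [x]" | x y where "p = [x, y]"
      by (cases p rule: remdups_adj.cases) (auto simp: Suc_le_eq numeral_3_eq_3)
    then show False
      using p(1) adjD(3)[OF assms]
      by cases (auto simp: walk_def adjacent_def delete_edge_def)
  qed
  ultimately have "cycle_in G p"
    using p(2) adjacent_sym[OF assms] by (auto simp: cycle_in_def walk_def)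
  then show False using tree by (auto simp: finite_tree_def)
qed

text \<open>This is the bipartiteness of trees. If both ends were equally far from \<open>u\<close>,
  shortest paths from \<open>a\<close> and from \<open>b\<close> to \<open>u\<close> would avoid the
  edge \<open>ab\<close>, because each of their steps changes the distance to \<open>u\<close>. This
  contradicts \<open>bridge\<close>.\<close>

lemma dist_adj_neq:
  assumes u: "u \<in> vertices G" and ab: "adjacent G a b"
  shows "d u a \<noteq> d u b"
proof
  assume eq: "d u a = d u b"
  have *: "reach (delete_edge G {a, b}) x u" if "x \<in> vertices G" for x
    using that
  proof (induction "d u x" arbitrary: x rule: less_induct)
    case less
    show ?case
    proof (cases "x = u")
      case False
      then obtain z where z: "adjacent G z x" "d u x = Suc (d u z)"
        using closer_neighbour[OF u less.prems] by metis
      have "{z, x} \<noteq> {a, b}" using z(2) eq by (auto simp: doubleton_eq_iff)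
      then have "adjacent (delete_edge G {a, b}) x z"
        using z(1) by (simp add: adjacent_def delete_edge_def insert_commute)
      moreover have "reach (delete_edge G {a, b}) z u"
        using less.hyps[of z] z adjD(1)[OF z(1)] by simp
      ultimately show ?thesis by (rule converse_rtranclp_into_rtranclp)
    qed simp
  qed
  have "reach (delete_edge G {a, b}) a b"
    using *[OF adjD(1)[OF ab]] reach_sym[OF *[OF adjD(2)[OF ab]]] by simp
  then show False using bridge[OF ab] by simp
qed

text \<open>If \<open>a\<close> and \<open>b\<close> differed, one could walk from \<open>b\<close>
  to \<open>u\<close>, from there to \<open>a\<close> and on to \<open>z\<close>. The shortest paths
  used stay strictly closer to \<open>u\<close> than \<open>z\<close> does, so this route avoids the
  edge \<open>bz\<close>, against \<open>bridge\<close>.\<close>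

lemma closer_unique:
  assumes u: "u \<in> vertices G" and a: "adjacent G a z" "d u a < d u z"
    and b: "adjacent G b z" "d u b < d u z"
  shows "a = b"
proof (rule ccontr)
  assume ne: "a \<noteq> b"
  let ?D = "delete_edge G {b, z}"
  have *: "reach ?D x u" if "x \<in> vertices G" "d u x < d u z" for x
    using that
  proof (induction "d u x" arbitrary: x rule: less_induct)
    case less
    show ?case
    proof (cases "x = u")
      case False
      then obtain y where y: "adjacent G y x" "d u x = Suc (d u y)"
        using closer_neighbour[OF u less.prems(1)] by metis
      have "{y, x} \<noteq> {b, z}" using y(2) less.prems(2) by (auto simp: doubleton_eq_iff)
      then have "adjacent ?D x y"
        using y(1) by (simp add: adjacent_def delete_edge_def insert_commute)
      moreover have "reach ?D y u"
        using less.hyps[of y] y less.prems adjD(1)[OF y(1)] by simp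
      ultimately show ?thesis by (rule converse_rtranclp_into_rtranclp)
    qed simp
  qed
  have "reach ?D b a"
    using *[OF adjD(1)[OF b(1)] b(2)] reach_sym[OF *[OF adjD(1)[OF a(1)] a(2)]] by simp
  moreover have "adjacent ?D a z"
    using a(1) ne adjD(3)[OF a(1)] by (auto simp: adjacent_def delete_edge_def doubleton_eq_iff)
  ultimately have "reach ?D b z" by simp
  then show False using bridge[OF b(1)] by simp
qed

end

section \<open>Isomorphisms\<close>

lemma graph_isoD:
  assumes "graph_iso G H f"
  shows "bij_betw f (vertices G) (vertices H)"
    and "x \<in> vertices G \<Longrightarrow> f x \<in> vertices H"
    and "x \<in> vertices G \<Longrightarrow> y \<in> vertices G \<Longrightarrow> adjacent H (f x) (f y) \<longleftrightarrow> adjacent G x y"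
    and "x \<in> vertices G \<Longrightarrow> y \<in> vertices G \<Longrightarrow> f x = f y \<longleftrightarrow> x = y"
  using assms by (auto simp: graph_iso_def bij_betw_def inj_on_eq_iff)

lemma graph_iso_id: "graph_iso G G (\<lambda>x. x)"
  by (simp add: graph_iso_def bij_betw_def)

lemma graph_iso_comp:
  assumes "graph_iso G H f" "graph_iso H K g"
  shows "graph_iso G K (\<lambda>x. g (f x))"
  using bij_betw_trans[OF graph_isoD(1)[OF assms(1)] graph_isoD(1)[OF assms(2)]]
    graph_isoD(2,3)[OF assms(1)] graph_isoD(3)[OF assms(2)]
  by (simp add: graph_iso_def comp_def)

lemma graph_iso_cong:
  assumes "graph_iso G H f" "\<And>x. x \<in> vertices G \<Longrightarrow> f' x = f x"
  shows "graph_iso G H f'"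
  using assms unfolding graph_iso_def by (simp cong: bij_betw_cong)

lemma graph_iso_inv:
  assumes "graph_iso G H f"
  obtains g where "graph_iso H G g" "\<And>x. x \<in> vertices G \<Longrightarrow> g (f x) = x"
    "\<And>y. y \<in> vertices H \<Longrightarrow> f (g y) = y"
proof -
  let ?g = "inv_into (vertices G) f"
  note b = graph_isoD(1)[OF assms]
  have fg: "f (?g y) = y" and gG: "?g y \<in> vertices G" if "y \<in> vertices H" for y
    using b that by (auto simp: bij_betw_def f_inv_into_f inv_into_into)
  have "graph_iso H G ?g"
    unfolding graph_iso_def
  proof (intro conjI ballI)
    fix x y assume "x \<in> vertices H" "y \<in> vertices H"
    then show "adjacent H x y \<longleftrightarrow> adjacent G (?g x) (?g y)"
      using graph_isoD(3)[OF assms gG gG] fg by metis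
  qed (rule bij_betw_inv_into[OF b])
  then show thesis
    using that fg bij_betw_inv_into_left[OF b] by blast
qed

lemma graph_iso_edge:
  assumes "graph_iso G H f" "simple_graph G" "e \<in> edges G"
  shows "f ` e \<in> edges H"
proof -
  obtain x y where "e = {x, y}" "x \<in> vertices G" "y \<in> vertices G" "adjacent G x y"
    using simple_graph_edgeE[OF assms(2,3)] .
  then show ?thesis
    using graph_isoD(3)[OF assms(1), of x y] by (simp add: adjacent_def)
qed

lemma simple_graph_edge_vertex:
  "simple_graph G \<Longrightarrow> e \<in> edges G \<Longrightarrow> x \<in> e \<Longrightarrow> x \<in> vertices G"
  by (auto simp: simple_graph_def)

lemma graph_iso_relpowp:
  assumes "graph_iso G H f" "simple_graph G" "x \<in> vertices G" "(adjacent G ^^ n) x y"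
  shows "(adjacent H ^^ n) (f x) (f y)"
  using assms(4)
proof (induction n arbitrary: y)
  case (Suc n)
  then obtain z where z: "(adjacent G ^^ n) x z" "adjacent G z y"
    by (auto elim: relpowp_Suc_E)
  then have "adjacent H (f z) (f y)"
    using simple_graph_adjacentD[OF assms(2) z(2)] graph_isoD(3)[OF assms(1)] by blast
  then show ?case using Suc.IH[OF z(1)] by (rule relpowp_Suc_I[rotated])
qed simp

lemma graph_iso_dist:
  assumes f: "graph_iso G H f" and G: "simple_graph G" and H: "simple_graph H"
    and x: "x \<in> vertices G" and y: "y \<in> vertices G"
  shows "graph_dist H (f x) (f y) = graph_dist G x y"
proof -
  obtain g where g: "graph_iso H G g" "\<And>x. x \<in> vertices G \<Longrightarrow> g (f x) = x"
    using graph_iso_inv[OF f] by metis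
  have "(adjacent H ^^ n) (f x) (f y) \<longleftrightarrow> (adjacent G ^^ n) x y" for n
    using graph_iso_relpowp[OF f G x] graph_iso_relpowp[OF g(1) H graph_isoD(2)[OF f x]]
      g(2)[OF x] g(2)[OF y] by metis
  then show ?thesis
    using graph_dist_relpowp[OF G x] graph_dist_relpowp[OF H graph_isoD(2)[OF f x]] by simp
qed

section \<open>Edges and non-root vertices of a rooted tree\<close>

definition rooted_distinguishing_vertex_labeling ::
    "'a ugraph \<Rightarrow> 'a \<Rightarrow> nat \<Rightarrow> ('a \<Rightarrow> nat) \<Rightarrow> bool" where
  "rooted_distinguishing_vertex_labeling G r k \<phi> \<longleftrightarrow> \<phi> ` vertices G \<subseteq> {1..k}
     \<and> (\<forall>\<alpha>. rooted_aut G r \<alpha> \<and> (\<forall>x\<in>vertices G. \<phi> (\<alpha> x) = \<phi> x) \<longrightarrow> (\<forall>x\<in>vertices G. \<alpha> x = x))"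

locale rooted_tree = tree +
  fixes r :: 'a
  assumes root: "r \<in> vertices G"
begin

text \<open>Away from the root, \<open>closer_unique\<close> leaves \<open>SOME\<close> no real
  choice. At the root no vertex qualifies and the value is unspecified.\<close>

definition parent :: "'a \<Rightarrow> 'a" where
  "parent x = (SOME y. adjacent G y x \<and> d r y < d r x)"

text \<open>This names the end of an edge farther from the root and inverts the map from non-root
  vertices \<open>x\<close> to edges \<open>{parent x, x}\<close>.\<close>

definition child :: "'a set \<Rightarrow> 'a" where
  "child e = (SOME x. x \<in> vertices G - {r} \<and> e = {parent x, x})"

lemma parent:
  assumes "x \<in> vertices G" "x \<noteq> r"
  shows "adjacent G (parent x) x" "d r (parent x) < d r x"
proof -
  have "\<exists>y. adjacent G y x \<and> d r y < d r x"
    using closer_neighbour[OF root assms(1)] assms(2) by (metis lessI)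
  then have "adjacent G (parent x) x \<and> d r (parent x) < d r x"
    unfolding parent_def by (rule someI_ex)
  then show "adjacent G (parent x) x" "d r (parent x) < d r x" by auto
qed

lemma parent_eqI:
  assumes "adjacent G y x" "d r y < d r x"
  shows "parent x = y"
proof -
  have "x \<noteq> r" using assms(2) dist_self[OF root] by auto
  then show ?thesis
    using closer_unique[OF root parent assms] adjD(2)[OF assms(1)] by simp
qed

text \<open>The ends differ in their distance from the root by \<open>dist_adj_neq\<close>, so the
  nearer one is the parent of the other.\<close>

lemma edge_parent:
  assumes "e \<in> edges G"
  obtains x where "x \<in> vertices G" "x \<noteq> r" "e = {parent x, x}"
proof -
  obtain a b where e: "e = {a, b}" "adjacent G a b"
    using simple_graph_edgeE[OF simple assms] .
  have "\<exists>a b. e = {a, b} \<and> adjacent G a b \<and> d r a < d r b"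
    using dist_adj_neq[OF root e(2)] e adjacent_sym[OF e(2)]
    by (metis insert_commute linorder_neqE_nat)
  then obtain a b where e': "e = {a, b}" "adjacent G a b" "d r a < d r b" by auto
  show thesis
  proof (rule that)
    show "e = {parent b, b}" using e' parent_eqI by simp
  qed (use e' dist_self[OF root] adjD in auto)
qed

lemma parent_edge: "x \<in> vertices G \<Longrightarrow> x \<noteq> r \<Longrightarrow> {parent x, x} \<in> edges G"
  using parent(1) by (simp add: adjacent_def)

lemma child_parent:
  assumes "x \<in> vertices G" "x \<noteq> r"
  shows "child {parent x, x} = x"
  unfolding child_def
proof (rule some_equality)
  fix y assume y: "y \<in> vertices G - {r} \<and> {parent x, x} = {parent y, y}"
  then show "y = x"
    using parent(2)[OF assms] parent(2)[of y] by (auto simp: doubleton_eq_iff)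
qed (use assms in auto)

lemma child_vertex:
  assumes "e \<in> edges G"
  shows "child e \<in> vertices G" "child e \<noteq> r" "{parent (child e), child e} = e"
  using edge_parent[OF assms] child_parent by metis+

text \<open>Automorphisms fixing the root preserve the distance to it and therefore commute with
  \<open>parent\<close>. This makes the correspondence of non-root vertices and edges
  equivariant.\<close>

lemma parent_aut:
  assumes \<alpha>: "rooted_aut G r \<alpha>" and x: "x \<in> vertices G" "x \<noteq> r"
  shows "\<alpha> x \<in> vertices G" "\<alpha> x \<noteq> r" "\<alpha> ` {parent x, x} = {parent (\<alpha> x), \<alpha> x}"
proof -
  have iso: "graph_iso G G \<alpha>" and r: "\<alpha> r = r"
    using \<alpha> by (auto simp: rooted_aut_def graph_aut_def)
  have px: "parent x \<in> vertices G" using adjD(1)[OF parent(1)[OF x]] .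
  show "\<alpha> x \<in> vertices G" using graph_isoD(2)[OF iso x(1)] .
  show "\<alpha> x \<noteq> r" using graph_isoD(4)[OF iso x(1) root] r x(2) by simp
  have "d r (\<alpha> y) = d r y" if "y \<in> vertices G" for y
    using graph_iso_dist[OF iso simple simple root that] r by simp
  then have "parent (\<alpha> x) = \<alpha> (parent x)"
    using parent[OF x] px x graph_isoD(3)[OF iso px x(1)] by (intro parent_eqI) auto
  then show "\<alpha> ` {parent x, x} = {parent (\<alpha> x), \<alpha> x}" by simp
qed

lemma child_aut:
  assumes "rooted_aut G r \<alpha>" "e \<in> edges G"
  shows "child (\<alpha> ` e) = \<alpha> (child e)"
  using child_vertex[OF assms(2)] parent_aut[OF assms(1)] child_parent by metis

text \<open>Each edge inherits the label of its child end. The label of the root gets lost, which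
  does no harm because rooted automorphisms fix the root.\<close>

lemma rooted_vertex_imp_edge_labeling:
  assumes "rooted_distinguishing_vertex_labeling G r k \<phi>"
  shows "rooted_distinguishing_edge_labeling G r k (\<lambda>e. \<phi> (child e))"
  unfolding rooted_distinguishing_edge_labeling_def
proof (intro conjI allI impI)
  show "(\<lambda>e. \<phi> (child e)) ` edges G \<subseteq> {1..k}"
    using assms child_vertex(1) by (auto simp: rooted_distinguishing_vertex_labeling_def)
  fix \<alpha> assume \<alpha>: "rooted_aut G r \<alpha> \<and> (\<forall>e\<in>edges G. \<phi> (child (\<alpha> ` e)) = \<phi> (child e))"
  have "\<phi> (\<alpha> x) = \<phi> x" if x: "x \<in> vertices G" for x
  proof (cases "x = r")
    case False
    then show ?thesis
      using \<alpha> child_aut[of \<alpha> "{parent x, x}"] parent_edge[OF x] child_parent[OF x] by auto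
  qed (use \<alpha> in \<open>simp add: rooted_aut_def\<close>)
  then show "\<forall>y\<in>vertices G. \<alpha> y = y"
    using assms \<alpha> by (simp add: rooted_distinguishing_vertex_labeling_def)
qed

text \<open>The root has no parent edge, so its label \<open>c\<close> is free. Choosing it
  differently in the two halves of a symmetric tree will exclude the swap.\<close>

lemma rooted_edge_imp_vertex_labeling:
  assumes "rooted_distinguishing_edge_labeling G r k g" "1 \<le> c" "c \<le> k"
  shows "rooted_distinguishing_vertex_labeling G r k (\<lambda>x. if x = r then c else g {parent x, x})"
    (is "rooted_distinguishing_vertex_labeling G r k ?\<phi>")
  unfolding rooted_distinguishing_vertex_labeling_def
proof (intro conjI allI impI)
  show "?\<phi> ` vertices G \<subseteq> {1..k}"
    using assms parent_edge by (auto simp: rooted_distinguishing_edge_labeling_def)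
  fix \<alpha> assume \<alpha>: "rooted_aut G r \<alpha> \<and> (\<forall>x\<in>vertices G. ?\<phi> (\<alpha> x) = ?\<phi> x)"
  have "g (\<alpha> ` e) = g e" if e: "e \<in> edges G" for e
  proof -
    obtain x where x: "x \<in> vertices G" "x \<noteq> r" "e = {parent x, x}"
      using edge_parent[OF e] by metis
    then have "?\<phi> (\<alpha> x) = g (\<alpha> ` e)" "?\<phi> x = g e"
      using parent_aut[OF _ x(1,2)] \<alpha> by auto
    then show ?thesis using \<alpha> x(1) by metis
  qed
  then show "\<forall>y\<in>vertices G. \<alpha> y = y"
    using assms(1) \<alpha> by (simp add: rooted_distinguishing_edge_labeling_def)
qed

end

section \<open>The center of a tree\<close>

context tree
begin

definition central :: "'a set" where
  "central = {x \<in> vertices G. \<forall>y\<in>vertices G. eccentricity G x \<le> eccentricity G y}"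

lemma center_eq: "center G = induced_subgraph G central"
  by (simp add: center_def central_def)

lemma finite_vertices: "finite (vertices G)"
  using simple by (simp add: simple_graph_def)

lemma vertices_nonempty: "vertices G \<noteq> {}"
  using tree by (simp add: finite_tree_def connected_graph_def)

lemma dist_sym:
  assumes "x \<in> vertices G" "y \<in> vertices G"
  shows "d x y = d y x"
proof -
  have *: "(adjacent G ^^ n) y x" if "(adjacent G ^^ n) x y" for n x y
    using that
  proof (induction n arbitrary: y)
    case (Suc n)
    then obtain z where "(adjacent G ^^ n) x z" "adjacent G z y" by (auto elim: relpowp_Suc_E)
    then show ?case using Suc.IH adjacent_sym relpowp_Suc_I2 by metis
  qed simp
  show ?thesis
    using dist_le[OF assms(1) *[OF relpowp_dist[OF assms(2,1)]]]
      dist_le[OF assms(2) *[OF relpowp_dist[OF assms]]] by simp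
qed

lemma dist_le_eccentricity:
  "x \<in> vertices G \<Longrightarrow> y \<in> vertices G \<Longrightarrow> d x y \<le> eccentricity G x"
  unfolding eccentricity_def using finite_vertices by simp

lemma eccentricity_attained:
  assumes "x \<in> vertices G"
  obtains y where "y \<in> vertices G" "eccentricity G x = d x y"
proof -
  have "eccentricity G x \<in> d x ` vertices G"
    unfolding eccentricity_def using finite_vertices vertices_nonempty by (intro Max_in) auto
  then show thesis using that by auto
qed

lemma eccentricity_aut:
  assumes "graph_aut G \<alpha>" "x \<in> vertices G"
  shows "eccentricity G (\<alpha> x) = eccentricity G x"
proof -
  have iso: "graph_iso G G \<alpha>" using assms(1) by (simp add: graph_aut_def)
  have "d (\<alpha> x) ` vertices G = d (\<alpha> x) ` \<alpha> ` vertices G"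
    using graph_isoD(1)[OF iso] by (simp add: bij_betw_def)
  also have "\<dots> = d x ` vertices G"
    using graph_iso_dist[OF iso simple simple assms(2)] by (auto simp: image_image)
  finally show ?thesis by (simp add: eccentricity_def)
qed

lemma central_aut:
  assumes "graph_aut G \<alpha>" "x \<in> central"
  shows "\<alpha> x \<in> central"
  using assms eccentricity_aut[OF assms(1)] graph_isoD(2)[of G G \<alpha>]
  by (auto simp: central_def graph_aut_def)

lemma central_nonempty: "central \<noteq> {}"
proof -
  obtain x where "x \<in> vertices G" "\<And>y. y \<in> vertices G \<Longrightarrow> eccentricity G x \<le> eccentricity G y"
    using ex_min_if_finite[of "eccentricity G ` vertices G"] finite_vertices vertices_nonempty
    by (smt (verit, best) finite_imageI image_iff image_is_empty linorder_not_le)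
  then show ?thesis by (auto simp: central_def)
qed

text \<open>
  Since \<open>b\<close> has only one neighbour closer to \<open>u\<close>, a step away from \<open>u\<close> on the way to \<open>x\<close> is
  followed by steps away from \<open>u\<close> only.
\<close>

lemma dist_keeps_increasing:
  assumes u: "u \<in> vertices G" and x: "x \<in> vertices G"
  shows "adjacent G a b \<Longrightarrow> d u a < d u b \<Longrightarrow> d x b < d x a \<Longrightarrow> d u x = d u b + d x b"
proof (induction "d x b" arbitrary: a b rule: less_induct)
  case less
  have b: "b \<in> vertices G" using adjD(2)[OF less.prems(1)] .
  show ?case
  proof (cases "x = b")
    case True
    then show ?thesis using dist_self[OF x] by simp
  next
    case False
    obtain z where z: "adjacent G z b" "d x b = Suc (d x z)"
      using closer_neighbour[OF x b False] .
    have "\<not> d u z < d u b"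
      using closer_unique[OF u less.prems(1,2) z(1)] z(2) less.prems(3) by auto
    then have "d u b < d u z" using dist_adj_neq[OF u z(1)] by simp
    moreover from this have "d u z = Suc (d u b)"
      using dist_adj[OF u adjacent_sym[OF z(1)]] by simp
    ultimately show ?thesis
      using less.hyps[of z b] z adjacent_sym[OF z(1)] by simp
  qed
qed

text \<open>Let \<open>z\<close> be the neighbour of \<open>y\<close> towards \<open>x\<close>, and
  \<open>u\<close> a vertex farthest from \<open>z\<close>. As \<open>z\<close> has at least the
  minimum eccentricity, the step from \<open>y\<close> to \<open>z\<close> leads away from
  \<open>u\<close>, and so does the rest of the way to \<open>x\<close>. Unless
  \<open>x = z\<close>, the vertex \<open>x\<close> would then be farther from \<open>u\<close> than
  its eccentricity allows.\<close>

lemma central_adjacent: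
  assumes x: "x \<in> central" and y: "y \<in> central" and ne: "x \<noteq> y"
  shows "adjacent G x y"
proof -
  have xV: "x \<in> vertices G" and yV: "y \<in> vertices G" using x y by (auto simp: central_def)
  have ecc: "eccentricity G y = eccentricity G x"
    using x y by (auto simp: central_def intro: antisym)
  obtain z where z: "adjacent G z y" "d x y = Suc (d x z)"
    using closer_neighbour[OF xV yV ne] .
  have zV: "z \<in> vertices G" using adjD(1)[OF z(1)] .
  obtain u where u: "u \<in> vertices G" "eccentricity G z = d z u"
    using eccentricity_attained[OF zV] .
  have uz: "eccentricity G x \<le> d u z"
    using x zV unfolding central_def dist_sym[OF u(1) zV] u(2)[symmetric] by simp
  have "d u y \<le> eccentricity G x"
    using dist_le_eccentricity[OF yV u(1)] ecc dist_sym[OF yV u(1)] by simp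
  then have "d u y < d u z"
    using uz dist_adj_neq[OF u(1) z(1)] by simp
  then have "d u x = d u z + d x z"
    using dist_keeps_increasing[OF u(1) xV adjacent_sym[OF z(1)]] z(2) by simp
  then have "d x z = 0"
    using uz dist_le_eccentricity[OF xV u(1)] dist_sym[OF xV u(1)] by simp
  then show ?thesis using dist_eq_0[OF xV zV] z(1) by simp
qed

text \<open>Seen from \<open>a\<close>, both \<open>b\<close> and \<open>c\<close> are at distance
  1, which \<open>dist_adj_neq\<close> excludes for adjacent vertices.\<close>

lemma no_triangle:
  assumes "adjacent G a b" "adjacent G b c" "adjacent G a c"
  shows False
proof -
  have a: "a \<in> vertices G" using adjD(1)[OF assms(1)] .
  have "d a x = 1" if "adjacent G a x" for x
    using dist_adj[OF a that] dist_self[OF a] dist_adj_neq[OF a that] by simp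
  then show False using dist_adj_neq[OF a assms(2)] assms by simp
qed

text \<open>Central vertices are pairwise adjacent, so a third one would complete a
  triangle.\<close>

lemma central_cases:
  obtains c where "central = {c}" | v w where "central = {v, w}" "adjacent G v w"
proof -
  obtain v where v: "v \<in> central" using central_nonempty by auto
  show thesis
  proof (cases "central = {v}")
    case False
    then obtain w where w: "w \<in> central" "v \<noteq> w" using v by auto
    then have "x \<in> {v, w}" if "x \<in> central" for x
      using central_adjacent[OF v w(1)] central_adjacent[OF w(1) that]
        central_adjacent[OF v that] no_triangle by auto
    then have "central = {v, w}" using v w by auto
    then show thesis using that(2) central_adjacent[OF v w] by simp
  qed (rule that(1))
qed

lemma bicentric_withI:
  assumes "central = {v, w}" "adjacent G v w"
  shows "bicentric_with G v w"
proof -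
  have "e = {v, w}" if e: "e \<in> edges G" "e \<subseteq> {v, w}" for e
  proof (rule card_subset_eq[OF _ e(2)])
    show "card e = card {v, w}"
      using e(1) simple adjD(3)[OF assms(2)] by (simp add: simple_graph_def)
  qed simp
  then have "{e \<in> edges G. e \<subseteq> {v, w}} = {{v, w}}"
    using assms(2) by (auto simp: adjacent_def)
  moreover have "vertices G \<inter> {v, w} = {v, w}" using adjD[OF assms(2)] by auto
  ultimately show ?thesis
    using adjD(3)[OF assms(2)] assms(1)
    by (simp add: bicentric_with_def center_eq induced_subgraph_def)
qed

lemma bicentric_withD:
  assumes "bicentric_with G v w"
  shows "central = {v, w}" "adjacent G v w"
proof -
  have "induced_subgraph G central = \<lparr>vertices = {v, w}, edges = {{v, w}}\<rparr>"
    using assms by (simp add: bicentric_with_def center_eq)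
  then have "vertices G \<inter> central = {v, w}" "{e \<in> edges G. e \<subseteq> central} = {{v, w}}"
    by (auto simp: induced_subgraph_def)
  then show "central = {v, w}" "adjacent G v w"
    by (auto simp: central_def adjacent_def)
qed

end

section \<open>The two halves of a tree with respect to an edge\<close>

locale tree_edge = tree +
  fixes v w :: 'a
  assumes vw: "adjacent G v w"
begin

text \<open>Interpreting the locale with the ends exchanged makes every fact about the half at
  \<open>v\<close> available for the half at \<open>w\<close>.\<close>

lemma swap: "tree_edge G w v"
  using tree vw adjacent_sym by (simp add: tree_edge_def tree_def tree_edge_axioms_def)

lemma adjacent_delete_edge:
  "adjacent (delete_edge G {v, w}) x y \<longleftrightarrow> adjacent G x y \<and> {x, y} \<noteq> {v, w}"
  by (auto simp: adjacent_def delete_edge_def)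

lemma simple_delete_edge: "simple_graph (delete_edge G {v, w})"
  using simple by (auto simp: simple_graph_def delete_edge_def)

lemma delete_edge_vertices: "vertices (delete_edge G {v, w}) = vertices G"
  by (simp add: delete_edge_def)

lemma half_vertices: "vertices (half_tree G v w) = {x \<in> vertices G. reach (delete_edge G {v, w}) v x}"
  using walk_iff_reach[OF simple_delete_edge, of v] adjD(1)[OF vw]
  by (auto simp: half_tree_def component_of_def induced_subgraph_def delete_edge_vertices)

lemma half_edges:
  "edges (half_tree G v w) = {e \<in> edges G. e \<noteq> {v, w} \<and> e \<subseteq> vertices (half_tree G v w)}"
  using simple
  by (auto simp: half_tree_def component_of_def induced_subgraph_def delete_edge_def simple_graph_def)

lemma half_vertex: "x \<in> vertices (half_tree G v w) \<Longrightarrow> x \<in> vertices G"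
  by (simp add: half_vertices)

lemma half_root: "v \<in> vertices (half_tree G v w)"
  using adjD(1)[OF vw] by (simp add: half_vertices)

lemma half_other: "w \<notin> vertices (half_tree G v w)"
  using bridge[OF vw] by (simp add: half_vertices)

lemma half_disjoint: "vertices (half_tree G v w) \<inter> vertices (half_tree G w v) = {}"
proof -
  interpret s: tree_edge G w v by (rule swap)
  have False if "x \<in> vertices (half_tree G v w)" "x \<in> vertices (half_tree G w v)" for x
  proof -
    have "reach (delete_edge G {v, w}) v x" "reach (delete_edge G {v, w}) w x"
      using that by (simp_all add: half_vertices s.half_vertices insert_commute)
    then show False using bridge[OF vw] reach_sym rtranclp_trans by metis
  qed
  then show ?thesis by auto
qed

text \<open>Follow a path from \<open>v\<close>: a step along \<open>vw\<close> lands on one of the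
  two roots, and any other step survives the deletion and stays in the same half.\<close>

lemma half_union: "vertices (half_tree G v w) \<union> vertices (half_tree G w v) = vertices G"
proof -
  interpret s: tree_edge G w v by (rule swap)
  have "x \<in> vertices (half_tree G v w) \<union> vertices (half_tree G w v)" if "x \<in> vertices G" for x
    using finite_tree_reach[OF tree adjD(1)[OF vw] that]
  proof (induction rule: rtranclp_induct)
    case base
    then show ?case using half_root by simp
  next
    case (step y z)
    show ?case
    proof (cases "{y, z} = {v, w}")
      case True
      then show ?thesis using half_root s.half_root by (auto simp: doubleton_eq_iff)
    next
      case False
      then have "adjacent (delete_edge G {v, w}) y z"
        using step.hyps(2) adjacent_delete_edge by simp
      then show ?thesis
        using step.IH adjD(2)[OF step.hyps(2)]
        by (auto simp: half_vertices s.half_vertices insert_commute intro: rtranclp.rtrancl_into_rtrancl)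
    qed
  qed
  then show ?thesis using half_vertex s.half_vertex by auto
qed

lemma half_adjacent:
  assumes "x \<in> vertices (half_tree G v w)" "y \<in> vertices (half_tree G v w)"
  shows "adjacent (half_tree G v w) x y \<longleftrightarrow> adjacent G x y"
  using assms half_other by (auto simp: adjacent_def half_edges doubleton_eq_iff)

text \<open>Any edge other than \<open>vw\<close> survives the deletion and would put
  \<open>y\<close> into the half of \<open>v\<close> as well.\<close>

lemma half_cross:
  assumes x: "x \<in> vertices (half_tree G v w)" and y: "y \<in> vertices (half_tree G w v)"
  shows "adjacent G x y \<longleftrightarrow> x = v \<and> y = w"
proof
  assume xy: "adjacent G x y"
  interpret s: tree_edge G w v by (rule swap)
  have "{x, y} = {v, w}"
  proof (rule ccontr)
    assume "{x, y} \<noteq> {v, w}"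
    then have "reach (delete_edge G {v, w}) v y"
      using xy x adjacent_delete_edge by (auto simp: half_vertices intro: rtranclp.rtrancl_into_rtrancl)
    then have "y \<in> vertices (half_tree G v w)" using adjD(2)[OF xy] by (simp add: half_vertices)
    then show False using half_disjoint y by auto
  qed
  then show "x = v \<and> y = w" using half_other x by (auto simp: doubleton_eq_iff)
qed (use vw in simp)

lemma half_edges_cases:
  assumes "e \<in> edges G"
  shows "e \<in> edges (half_tree G v w) \<or> e \<in> edges (half_tree G w v) \<or> e = {v, w}"
proof -
  interpret s: tree_edge G w v by (rule swap)
  obtain x y where e: "e = {x, y}" "adjacent G x y"
    using simple_graph_edgeE[OF simple assms] .
  then show ?thesis
    using half_union adjD(1,2)[OF e(2)] half_cross[of x y] half_cross[of y x] adjacent_sym[OF e(2)] assms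
    by (auto simp: half_edges s.half_edges doubleton_eq_iff)
qed

lemma simple_half: "simple_graph (half_tree G v w)"
  using simple finite_subset[of "vertices (half_tree G v w)" "vertices G"] half_vertex
  by (auto simp: simple_graph_def half_edges)

lemma finite_tree_half: "finite_tree (half_tree G v w)"
proof (rule finite_treeI[OF simple_half])
  let ?H = "half_tree G v w"
  show "vertices ?H \<noteq> {}" using half_root by auto
  have *: "reach ?H v x" if "reach (delete_edge G {v, w}) v x" for x
    using that
  proof (induction rule: rtranclp_induct)
    case (step y z)
    have "adjacent G y z" using step.hyps(2) by (simp add: adjacent_delete_edge)
    then have "adjacent ?H y z"
      using half_adjacent[of y z] step.hyps adjD(1,2)[of y z] rtranclp.rtrancl_into_rtrancl[OF step.hyps]
      by (simp add: half_vertices)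
    with step.IH show ?case by simp
  qed simp
  show "reach ?H x y" if "x \<in> vertices ?H" "y \<in> vertices ?H" for x y
    using *[of x] *[of y] that reach_sym[of ?H v x] by (auto simp: half_vertices)
  show "\<not> cycle_in ?H p" for p
  proof
    assume c: "cycle_in ?H p"
    have imp: "adjacent ?H x y \<Longrightarrow> adjacent G x y" for x y
      by (simp add: adjacent_def half_edges)
    have "cycle_in G p"
      using c half_vertex unfolding cycle_in_def walk_def
      by (auto intro: imp successively_mono[OF _ imp])
    then show False using tree by (simp add: finite_tree_def)
  qed
qed

end

text \<open>Only the edge \<open>vw\<close> joins the halves, so sending roots to roots is all the
  compatibility that the two isomorphisms need. For \<open>(v', w') = (v, w)\<close> the result
  fixes both ends, for \<open>(v', w') = (w, v)\<close> it swaps them.\<close>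

lemma glue:
  assumes S: "tree_edge G v w" and S': "tree_edge G v' w'"
    and a: "graph_iso (half_tree G v w) (half_tree G v' w') a" "a v = v'"
    and b: "graph_iso (half_tree G w v) (half_tree G w' v') b" "b w = w'"
  shows "graph_aut G (\<lambda>x. if x \<in> vertices (half_tree G v w) then a x else b x)"
    (is "graph_aut G ?f")
proof -
  interpret S: tree_edge G v w by (rule S)
  interpret S': tree_edge G v' w' by (rule S')
  interpret T: tree_edge G w v by (rule S.swap)
  interpret T': tree_edge G w' v' by (rule S'.swap)
  let ?H = "vertices (half_tree G v w)" and ?K = "vertices (half_tree G w v)"
  let ?H' = "vertices (half_tree G v' w')" and ?K' = "vertices (half_tree G w' v')"
  have fH: "?f x = a x" if "x \<in> ?H" for x using that by simp
  have fK: "?f x = b x" if "x \<in> ?K" for x using that S.half_disjoint by auto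
  have "bij_betw ?f ?H ?H'" using graph_isoD(1)[OF a(1)] by (simp cong: bij_betw_cong)
  moreover have "bij_betw ?f ?K ?K'"
    using graph_isoD(1)[OF b(1)] fK bij_betw_cong[of ?K ?f b] by blast
  ultimately have bij: "bij_betw ?f (vertices G) (vertices G)"
    using bij_betw_combine[of ?f ?H ?H' ?K ?K'] S'.half_disjoint S.half_union S'.half_union by simp
  have cross: "adjacent G (?f x) (?f y) \<longleftrightarrow> adjacent G x y" if x: "x \<in> ?H" and y: "y \<in> ?K" for x y
  proof -
    have "a x = v' \<longleftrightarrow> x = v" "b y = w' \<longleftrightarrow> y = w"
      using graph_isoD(4)[OF a(1) x S.half_root] graph_isoD(4)[OF b(1) y T.half_root] a(2) b(2) by auto
    then show ?thesis
      using S.half_cross[OF x y] S'.half_cross[OF graph_isoD(2)[OF a(1) x] graph_isoD(2)[OF b(1) y]]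
        fH[OF x] fK[OF y] by simp
  qed
  have "adjacent G (?f x) (?f y) \<longleftrightarrow> adjacent G x y"
    if x: "x \<in> vertices G" and y: "y \<in> vertices G" for x y
  proof -
    consider "x \<in> ?H" "y \<in> ?H" | "x \<in> ?K" "y \<in> ?K" | "x \<in> ?H" "y \<in> ?K" | "y \<in> ?H" "x \<in> ?K"
      using x y S.half_union by auto
    then show ?thesis
    proof cases
      case 1
      then show ?thesis
        using S.half_adjacent[of x y] S'.half_adjacent[of "a x" "a y"]
          graph_isoD(2,3)[OF a(1)] by simp
    next
      case 2
      then show ?thesis
        unfolding fK[OF 2(1)] fK[OF 2(2)]
        using T.half_adjacent[of x y] T'.half_adjacent[of "b x" "b y"]
          graph_isoD(2,3)[OF b(1)] by simp
    next
      case 3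
      then show ?thesis by (rule cross)
    next
      case 4
      then show ?thesis using cross[of y x] adjacent_commute by metis
    qed
  qed
  with bij show ?thesis by (auto simp: graph_aut_def graph_iso_def)
qed

text \<open>An automorphism carries a path avoiding the edge \<open>vw\<close> to a path avoiding
  its image.\<close>

lemma aut_half_subset:
  assumes S: "tree_edge G v w" and \<alpha>: "graph_aut G \<alpha>" and x: "x \<in> vertices (half_tree G v w)"
  shows "\<alpha> x \<in> vertices (half_tree G (\<alpha> v) (\<alpha> w))"
proof -
  interpret S: tree_edge G v w by (rule S)
  have iso: "graph_iso G G \<alpha>" using \<alpha> by (simp add: graph_aut_def)
  note vw = S.adjD[OF S.vw]
  interpret S': tree_edge G "\<alpha> v" "\<alpha> w"
    by unfold_locales (use S.vw vw graph_isoD(3)[OF iso] in simp)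
  have "reach (delete_edge G {\<alpha> v, \<alpha> w}) (\<alpha> v) (\<alpha> x)"
    if "reach (delete_edge G {v, w}) v x" for x
    using that
  proof (induction rule: rtranclp_induct)
    case (step y z)
    then have yz: "adjacent G y z" "{y, z} \<noteq> {v, w}" by (simp_all add: S.adjacent_delete_edge)
    then have "adjacent (delete_edge G {\<alpha> v, \<alpha> w}) (\<alpha> y) (\<alpha> z)"
      using S.adjD[OF yz(1)] vw graph_isoD(3,4)[OF iso]
      by (auto simp: S'.adjacent_delete_edge doubleton_eq_iff)
    with step.IH show ?case by simp
  qed simp
  then show ?thesis
    using x graph_isoD(2)[OF iso] by (simp add: S.half_vertices S'.half_vertices)
qed

lemma aut_half_iso:
  assumes S: "tree_edge G v w" and \<alpha>: "graph_aut G \<alpha>"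
  shows "graph_iso (half_tree G v w) (half_tree G (\<alpha> v) (\<alpha> w)) \<alpha>"
proof -
  interpret S: tree_edge G v w by (rule S)
  have iso: "graph_iso G G \<alpha>" using \<alpha> by (simp add: graph_aut_def)
  interpret S': tree_edge G "\<alpha> v" "\<alpha> w"
    by unfold_locales (use S.vw S.adjD[OF S.vw] graph_isoD(3)[OF iso] in simp)
  let ?H = "vertices (half_tree G v w)" and ?H' = "vertices (half_tree G (\<alpha> v) (\<alpha> w))"
  have sub: "\<alpha> ` ?H \<subseteq> ?H'" using aut_half_subset[OF S \<alpha>] by auto
  have "\<alpha> ` ?H = ?H'"
  proof (intro equalityI sub subsetI)
    fix y assume y: "y \<in> ?H'"
    then obtain x where x: "x \<in> vertices G" "y = \<alpha> x"
      using graph_isoD(1)[OF iso] S'.half_vertex by (auto simp: bij_betw_def)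
    \<comment> \<open>A preimage in the half at \<open>w\<close> would be sent to the half at
      \<open>\<alpha> w\<close>, which is disjoint from the half at
      \<open>\<alpha> v\<close>.\<close>
    moreover have "x \<notin> vertices (half_tree G w v)"
      using aut_half_subset[OF S.swap \<alpha>, of x] S'.half_disjoint y x(2) by auto
    ultimately show "y \<in> \<alpha> ` ?H" using S.half_union by auto
  qed
  then have "bij_betw \<alpha> ?H ?H'"
    using graph_isoD(1)[OF iso] S.half_vertex by (auto simp: bij_betw_def intro: inj_on_subset)
  moreover have "adjacent (half_tree G v w) x y \<longleftrightarrow> adjacent (half_tree G (\<alpha> v) (\<alpha> w)) (\<alpha> x) (\<alpha> y)"
    if "x \<in> ?H" "y \<in> ?H" for x y
    using that S.half_adjacent S'.half_adjacent sub graph_isoD(3)[OF iso] S.half_vertex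
    by (metis image_subset_iff)
  ultimately show ?thesis by (simp add: graph_iso_def)
qed

text \<open>Whether a glued automorphism preserves edge labels is checked on three kinds of edges:
  those of either half and the joining edge.\<close>

lemma glue_image:
  assumes "tree_edge G v w" "a v = v'" "b w = w'"
  shows "e \<in> edges (half_tree G v w) \<Longrightarrow>
      (\<lambda>x. if x \<in> vertices (half_tree G v w) then a x else b x) ` e = a ` e"
    and "e \<in> edges (half_tree G w v) \<Longrightarrow>
      (\<lambda>x. if x \<in> vertices (half_tree G v w) then a x else b x) ` e = b ` e"
    and "(\<lambda>x. if x \<in> vertices (half_tree G v w) then a x else b x) ` {v, w} = {v', w'}"
proof -
  interpret S: tree_edge G v w by (rule assms)
  interpret T: tree_edge G w v by (rule S.swap)
  show "(\<lambda>x. if x \<in> vertices (half_tree G v w) then a x else b x) ` e = a ` e"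
    if "e \<in> edges (half_tree G v w)"
    using that S.half_edges by (intro image_cong) auto
  show "(\<lambda>x. if x \<in> vertices (half_tree G v w) then a x else b x) ` e = b ` e"
    if "e \<in> edges (half_tree G w v)"
    using that T.half_edges S.half_disjoint by (intro image_cong) auto
  show "(\<lambda>x. if x \<in> vertices (half_tree G v w) then a x else b x) ` {v, w} = {v', w'}"
    using S.half_root S.half_other assms by auto
qed

section \<open>Labelings of the halves\<close>

lemma rooted_autD:
  assumes "rooted_aut G r \<alpha>"
  shows "graph_iso G G \<alpha>" "\<alpha> r = r"
  using assms by (auto simp: rooted_aut_def graph_aut_def)

lemma rooted_autI: "graph_iso G G \<alpha> \<Longrightarrow> \<alpha> r = r \<Longrightarrow> rooted_aut G r \<alpha>"
  by (simp add: rooted_aut_def graph_aut_def)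

lemma distinguishing_vertex_labelingD:
  assumes "distinguishing_vertex_labeling G k \<phi>" "graph_aut G \<alpha>"
    and "\<And>x. x \<in> vertices G \<Longrightarrow> \<phi> (\<alpha> x) = \<phi> x" "x \<in> vertices G"
  shows "\<alpha> x = x"
  using assms unfolding distinguishing_vertex_labeling_def by blast

lemma distinguishing_edge_labelingD:
  assumes "distinguishing_edge_labeling G k g" "graph_aut G \<alpha>"
    and "\<And>e. e \<in> edges G \<Longrightarrow> g (\<alpha> ` e) = g e" "x \<in> vertices G"
  shows "\<alpha> x = x"
  using assms unfolding distinguishing_edge_labeling_def by blast

lemma rooted_distinguishing_vertex_labelingD:
  assumes "rooted_distinguishing_vertex_labeling G r k \<phi>" "rooted_aut G r \<alpha>"
    and "\<And>x. x \<in> vertices G \<Longrightarrow> \<phi> (\<alpha> x) = \<phi> x" "x \<in> vertices G"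
  shows "\<alpha> x = x"
  using assms unfolding rooted_distinguishing_vertex_labeling_def by blast

lemma rooted_distinguishing_edge_labelingD:
  assumes "rooted_distinguishing_edge_labeling G r k g" "rooted_aut G r \<alpha>"
    and "\<And>e. e \<in> edges G \<Longrightarrow> g (\<alpha> ` e) = g e" "x \<in> vertices G"
  shows "\<alpha> x = x"
  using assms unfolding rooted_distinguishing_edge_labeling_def by blast

section \<open>Transport of labelings along isomorphisms\<close>

lemma rooted_aut_conjugate:
  assumes f: "graph_iso G H f" "f x = y" "x \<in> vertices G" and \<alpha>: "rooted_aut G x \<alpha>"
    and h: "graph_iso H G h" "\<And>x. x \<in> vertices G \<Longrightarrow> h (f x) = x"
  shows "rooted_aut H y (\<lambda>z. f (\<alpha> (h z)))"
  using graph_iso_comp[OF h(1) graph_iso_comp[OF rooted_autD(1)[OF \<alpha>] f(1)]]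
    h(2)[OF f(3)] f(2) rooted_autD(2)[OF \<alpha>]
  by (auto intro: rooted_autI)

text \<open>Conjugation by \<open>f\<close> turns a label-preserving automorphism of
  \<open>G\<close> into one of \<open>H\<close>, which has to be trivial.\<close>

lemma rooted_vertex_labeling_transport:
  assumes \<phi>: "rooted_distinguishing_vertex_labeling H y k \<phi>"
    and f: "graph_iso G H f" "f x = y" "x \<in> vertices G"
  shows "rooted_distinguishing_vertex_labeling G x k (\<lambda>z. \<phi> (f z))"
  unfolding rooted_distinguishing_vertex_labeling_def
proof (intro conjI allI impI ballI)
  show "(\<lambda>z. \<phi> (f z)) ` vertices G \<subseteq> {1..k}"
    using \<phi> graph_isoD(2)[OF f(1)] by (auto simp: rooted_distinguishing_vertex_labeling_def)
  fix \<alpha> z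
  assume \<alpha>: "rooted_aut G x \<alpha> \<and> (\<forall>z\<in>vertices G. \<phi> (f (\<alpha> z)) = \<phi> (f z))" and z: "z \<in> vertices G"
  obtain h where h: "graph_iso H G h" "\<And>x. x \<in> vertices G \<Longrightarrow> h (f x) = x"
    "\<And>y. y \<in> vertices H \<Longrightarrow> f (h y) = y"
    using graph_iso_inv[OF f(1)] by metis
  have "\<phi> (f (\<alpha> (h u))) = \<phi> u" if "u \<in> vertices H" for u
    using \<alpha> graph_isoD(2)[OF h(1) that] h(3)[OF that] by simp
  then have "f (\<alpha> (h (f z))) = f z"
    using rooted_distinguishing_vertex_labelingD[OF \<phi> rooted_aut_conjugate[OF f conjunct1[OF \<alpha>] h(1,2)]]
      graph_isoD(2)[OF f(1) z] by blast
  then show "\<alpha> z = z"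
    using graph_isoD(2,4) f(1) h(2) z rooted_autD(1)[OF conjunct1[OF \<alpha>]] by metis
qed

lemma graph_iso_image_cancel:
  assumes "simple_graph H" "\<And>y. y \<in> vertices H \<Longrightarrow> f (h y) = y" "e \<in> edges H"
  shows "f ` h ` e = e"
proof -
  have "f (h y) = y" if "y \<in> e" for y
    using assms(2) simple_graph_edge_vertex[OF assms(1,3) that] .
  then show ?thesis by (auto simp: image_image)
qed

lemma rooted_edge_labeling_transport:
  assumes g: "rooted_distinguishing_edge_labeling H y k g"
    and f: "graph_iso G H f" "f x = y" "x \<in> vertices G"
    and G: "simple_graph G" and H: "simple_graph H"
  shows "rooted_distinguishing_edge_labeling G x k (\<lambda>e. g (f ` e))"
  unfolding rooted_distinguishing_edge_labeling_def
proof (intro conjI allI impI ballI)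
  show "(\<lambda>e. g (f ` e)) ` edges G \<subseteq> {1..k}"
    using g graph_iso_edge[OF f(1) G] by (auto simp: rooted_distinguishing_edge_labeling_def)
  fix \<alpha> z
  assume \<alpha>: "rooted_aut G x \<alpha> \<and> (\<forall>e\<in>edges G. g (f ` \<alpha> ` e) = g (f ` e))" and z: "z \<in> vertices G"
  obtain h where h: "graph_iso H G h" "\<And>x. x \<in> vertices G \<Longrightarrow> h (f x) = x"
    "\<And>y. y \<in> vertices H \<Longrightarrow> f (h y) = y"
    using graph_iso_inv[OF f(1)] by metis
  have "g ((\<lambda>z. f (\<alpha> (h z))) ` e) = g e" if "e \<in> edges H" for e
  proof -
    have "g (f ` \<alpha> ` h ` e) = g (f ` h ` e)"
      using \<alpha> graph_iso_edge[OF h(1) H that] by simp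
    then show ?thesis
      using graph_iso_image_cancel[of H f h, OF H h(3) that] by (simp add: image_image)
  qed
  then have "f (\<alpha> (h (f z))) = f z"
    using rooted_distinguishing_edge_labelingD[OF g rooted_aut_conjugate[OF f conjunct1[OF \<alpha>] h(1,2)]]
      graph_isoD(2)[OF f(1) z] by blast
  then show "\<alpha> z = z"
    using graph_isoD(2,4) f(1) h(2) z rooted_autD(1)[OF conjunct1[OF \<alpha>]] by metis
qed

lemma rooted_edge_labelings_isomorphic_refl:
  assumes "\<And>e. e \<in> edges G \<Longrightarrow> g e = g' e"
  shows "rooted_edge_labelings_isomorphic G r g g'"
  unfolding rooted_edge_labelings_isomorphic_def
  using assms by (intro exI[of _ "\<lambda>x. x"]) (simp add: rooted_autI graph_iso_id)

text \<open>The second automorphism is followed by the inverse of the first. If \<open>g\<close> is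
  the unique distinguishing labeling, any two distinguishing labelings are thus isomorphic to each
  other.\<close>

lemma rooted_edge_labelings_isomorphic_cancel:
  assumes "rooted_edge_labelings_isomorphic G r g g1" "rooted_edge_labelings_isomorphic G r g g2"
    and G: "simple_graph G" and r: "r \<in> vertices G"
  shows "rooted_edge_labelings_isomorphic G r g1 g2"
proof -
  obtain \<alpha> \<beta> where \<alpha>: "rooted_aut G r \<alpha>" "\<And>e. e \<in> edges G \<Longrightarrow> g1 e = g (\<alpha> ` e)"
    and \<beta>: "rooted_aut G r \<beta>" "\<And>e. e \<in> edges G \<Longrightarrow> g2 e = g (\<beta> ` e)"
    using assms(1,2) by (auto simp: rooted_edge_labelings_isomorphic_def)
  obtain h where h: "graph_iso G G h" "\<And>x. x \<in> vertices G \<Longrightarrow> h (\<alpha> x) = x"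
    "\<And>x. x \<in> vertices G \<Longrightarrow> \<alpha> (h x) = x"
    using graph_iso_inv[OF rooted_autD(1)[OF \<alpha>(1)]] by metis
  have "rooted_aut G r (\<lambda>x. h (\<beta> x))"
    using graph_iso_comp[OF rooted_autD(1)[OF \<beta>(1)] h(1)] rooted_autD(2)[OF \<beta>(1)]
      rooted_autD(2)[OF \<alpha>(1)] h(2)[OF r] by (auto intro: rooted_autI)
  moreover have "g2 e = g1 ((\<lambda>x. h (\<beta> x)) ` e)" if e: "e \<in> edges G" for e
  proof -
    have be: "\<beta> ` e \<in> edges G" using graph_iso_edge[OF rooted_autD(1)[OF \<beta>(1)] G e] .
    have "g1 (h ` \<beta> ` e) = g (\<alpha> ` h ` \<beta> ` e)"
      using \<alpha>(2) graph_iso_edge[OF h(1) G be] by simp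
    also have "\<dots> = g2 e"
      using graph_iso_image_cancel[of G \<alpha> h, OF G h(3) be] \<beta>(2)[OF e] by simp
    finally show ?thesis by (simp add: image_image)
  qed
  ultimately show ?thesis by (auto simp: rooted_edge_labelings_isomorphic_def)
qed

lemma distinguishing_imp_rooted:
  "distinguishing_vertex_labeling G k \<phi> \<Longrightarrow> rooted_distinguishing_vertex_labeling G r k \<phi>"
  "distinguishing_edge_labeling G k g \<Longrightarrow> rooted_distinguishing_edge_labeling G r k g"
  by (auto simp: distinguishing_vertex_labeling_def rooted_distinguishing_vertex_labeling_def
      distinguishing_edge_labeling_def rooted_distinguishing_edge_labeling_def rooted_aut_def)

section \<open>Restriction of labelings to a half\<close>

context tree_edge
begin

text \<open>Extension by the identity keeps labels on the other half untouched, so a distinguishing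
  labeling of the tree restricts to one of the half.\<close>

lemma extend_half_aut:
  assumes "rooted_aut (half_tree G v w) v \<alpha>"
  shows "rooted_aut G v (\<lambda>x. if x \<in> vertices (half_tree G v w) then \<alpha> x else x)"
  using glue[OF tree_edge_axioms tree_edge_axioms rooted_autD[OF assms] graph_iso_id]
    rooted_autD(2)[OF assms] by (simp add: rooted_aut_def)

lemma rooted_vertex_labeling_half:
  assumes "rooted_distinguishing_vertex_labeling G v k \<phi>"
  shows "rooted_distinguishing_vertex_labeling (half_tree G v w) v k \<phi>"
  unfolding rooted_distinguishing_vertex_labeling_def
proof (intro conjI allI impI ballI)
  let ?H = "half_tree G v w"
  show "\<phi> ` vertices ?H \<subseteq> {1..k}"
    using assms half_vertex by (auto simp: rooted_distinguishing_vertex_labeling_def)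
  fix \<alpha> z
  assume \<alpha>: "rooted_aut ?H v \<alpha> \<and> (\<forall>x\<in>vertices ?H. \<phi> (\<alpha> x) = \<phi> x)" and z: "z \<in> vertices ?H"
  have "(if z \<in> vertices ?H then \<alpha> z else z) = z"
    using rooted_distinguishing_vertex_labelingD[OF assms extend_half_aut[OF conjunct1[OF \<alpha>]]] \<alpha>
      half_vertex[OF z] by simp
  then show "\<alpha> z = z" using z by simp
qed

lemma rooted_edge_labeling_half:
  assumes "rooted_distinguishing_edge_labeling G v k g"
  shows "rooted_distinguishing_edge_labeling (half_tree G v w) v k g"
  unfolding rooted_distinguishing_edge_labeling_def
proof (intro conjI allI impI ballI)
  let ?H = "half_tree G v w"
  show "g ` edges ?H \<subseteq> {1..k}"
    using assms by (auto simp: rooted_distinguishing_edge_labeling_def half_edges)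
  fix \<alpha> z
  assume \<alpha>: "rooted_aut ?H v \<alpha> \<and> (\<forall>e\<in>edges ?H. g (\<alpha> ` e) = g e)" and z: "z \<in> vertices ?H"
  let ?f = "\<lambda>x. if x \<in> vertices ?H then \<alpha> x else x"
  note gi = glue_image[OF tree_edge_axioms, of \<alpha> v "\<lambda>x. x" w]
  have "g (?f ` e) = g e" if "e \<in> edges G" for e
    using half_edges_cases[OF that] gi(1,2)[of e] gi(3) \<alpha> rooted_autD(2)[of ?H v \<alpha>] by auto
  then have "?f z = z"
    using rooted_distinguishing_edge_labelingD[OF assms extend_half_aut[OF conjunct1[OF \<alpha>]]]
      half_vertex[OF z] by blast
  then show "\<alpha> z = z" using z by simp
qed

end

text \<open>If all automorphisms fix \<open>r\<close>, distinguishing and rooted distinguishing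
  labelings coincide, and labels can be moved between vertices and parent edges.\<close>

lemma (in rooted_tree) labelings_iff_if_root_fixed:
  assumes fixed: "\<And>\<alpha>. graph_aut G \<alpha> \<Longrightarrow> \<alpha> r = r" and "edges G \<noteq> {}"
  shows "(\<exists>\<phi>. distinguishing_vertex_labeling G k \<phi>) \<longleftrightarrow> (\<exists>g. distinguishing_edge_labeling G k g)"
proof -
  have v: "distinguishing_vertex_labeling G k = rooted_distinguishing_vertex_labeling G r k"
    using fixed by (auto simp: fun_eq_iff distinguishing_vertex_labeling_def
        rooted_distinguishing_vertex_labeling_def rooted_aut_def)
  have e: "distinguishing_edge_labeling G k = rooted_distinguishing_edge_labeling G r k"
    using fixed by (auto simp: fun_eq_iff distinguishing_edge_labeling_def
        rooted_distinguishing_edge_labeling_def rooted_aut_def)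
  \<comment> \<open>Some edge carries a label, so the label 1 is available for the root.\<close>
  have "1 \<le> k" if "rooted_distinguishing_edge_labeling G r k g" for g
    using that assms(2) by (fastforce simp: rooted_distinguishing_edge_labeling_def)
  then show ?thesis
    unfolding v e using rooted_vertex_imp_edge_labeling rooted_edge_imp_vertex_labeling[of k _ 1]
    by blast
qed

text \<open>An injective labeling distinguishes, so the \<open>LEAST\<close> in
  \<open>distinguishing_number\<close> is attained. \<open>Suc\<close> makes the labels start at
  1.\<close>

lemma (in tree) distinguishing_vertex_labeling_exists:
  "\<exists>k \<phi>. distinguishing_vertex_labeling G k \<phi>"
proof -
  obtain h where h: "bij_betw h (vertices G) {0..<card (vertices G)}"
    using ex_bij_betw_finite_nat[OF finite_vertices] by auto
  have "distinguishing_vertex_labeling G (card (vertices G)) (\<lambda>x. Suc (h x))"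
    unfolding distinguishing_vertex_labeling_def
  proof (intro conjI allI impI ballI)
    show "(\<lambda>x. Suc (h x)) ` vertices G \<subseteq> {1..card (vertices G)}"
      using h by (auto simp: bij_betw_def Suc_le_eq)
    fix \<alpha> x assume "graph_aut G \<alpha> \<and> (\<forall>x\<in>vertices G. Suc (h (\<alpha> x)) = Suc (h x))" "x \<in> vertices G"
    then show "\<alpha> x = x"
      using h graph_isoD(2)[of G G \<alpha>] by (auto simp: graph_aut_def bij_betw_def inj_on_eq_iff)
  qed
  then show ?thesis by blast
qed

section \<open>Bicentric trees with isomorphic halves\<close>

text \<open>Fixing one isomorphism \<open>f\<close> allows labelings of both halves to be compared
  on the half at \<open>v\<close>, by pulling back along \<open>f\<close>.\<close>

locale symmetric_tree = tree_edge +
  fixes f :: "'a \<Rightarrow> 'a"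
  assumes central: "central = {v, w}"
    and f: "graph_iso (half_tree G v w) (half_tree G w v) f" "f v = w"
begin

sublocale other: tree_edge G w v
  by (rule swap)

abbreviation H :: "'a ugraph" where "H \<equiv> half_tree G v w"
abbreviation K :: "'a ugraph" where "K \<equiv> half_tree G w v"

lemma v_neq_w: "v \<noteq> w"
  using adjD(3)[OF vw] .

lemma aut_cases:
  assumes "graph_aut G \<alpha>"
  obtains "\<alpha> v = v" "\<alpha> w = w" | "\<alpha> v = w" "\<alpha> w = v"
proof -
  have "\<alpha> v \<in> {v, w}" "\<alpha> w \<in> {v, w}" using central_aut[OF assms] central by auto
  moreover have "\<alpha> v \<noteq> \<alpha> w"
    using assms graph_isoD(4)[of G G \<alpha> v w] adjD[OF vw] by (auto simp: graph_aut_def)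
  ultimately show thesis using that by auto
qed

lemma rooted_aut_half:
  assumes "graph_aut G \<alpha>" "\<alpha> v = v" "\<alpha> w = w"
  shows "rooted_aut H v \<alpha>" "rooted_aut K w \<alpha>"
  using aut_half_iso[OF tree_edge_axioms assms(1)] aut_half_iso[OF swap assms(1)] assms
  by (auto intro: rooted_autI)

definition f' :: "'a \<Rightarrow> 'a" where "f' = inv_into (vertices H) f"

lemma f': "graph_iso K H f'" "f' w = v"
  and f'f: "x \<in> vertices H \<Longrightarrow> f' (f x) = x" and ff': "y \<in> vertices K \<Longrightarrow> f (f' y) = y"
proof -
  obtain h where h: "graph_iso K H h" "\<And>x. x \<in> vertices H \<Longrightarrow> h (f x) = x"
    "\<And>y. y \<in> vertices K \<Longrightarrow> f (h y) = y"
    using graph_iso_inv[OF f(1)] by metis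
  have f'h: "f' y = h y" if "y \<in> vertices K" for y
    unfolding f'_def using bij_betw_inv_into_left[OF graph_isoD(1)[OF f(1)] graph_isoD(2)[OF h(1) that]]
      h(3)[OF that] by simp
  show "graph_iso K H f'" using graph_iso_cong[OF h(1) f'h] .
  have *: "f' (f x) = x" if "x \<in> vertices H" for x
    using h(2)[OF that] f'h graph_isoD(2)[OF f(1) that] by simp
  then show "x \<in> vertices H \<Longrightarrow> f' (f x) = x" .
  show "f' w = v" using *[OF half_root] f(2) by simp
  show "y \<in> vertices K \<Longrightarrow> f (f' y) = y" using h(3) f'h by simp
qed

text \<open>\<open>g2\<close> goes on the half at \<open>v\<close> and a copy of \<open>g1\<close>
  on the half at \<open>w\<close>. A label-preserving automorphism fixing both ends is trivial on
  each half, and one swapping them would make \<open>g1\<close> and \<open>g2\<close>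
  isomorphic.\<close>

lemma edge_labeling_of_half_labelings:
  assumes g1: "rooted_distinguishing_edge_labeling H v k g1"
    and g2: "rooted_distinguishing_edge_labeling H v k g2"
    and ni: "\<not> rooted_edge_labelings_isomorphic H v g1 g2"
  shows "\<exists>g. distinguishing_edge_labeling G k g"
proof -
  \<comment> \<open>Any two labelings of an edgeless half are isomorphic. Hence there is an edge,
    and the label 1 is available.\<close>
  have "edges H \<noteq> {}" using ni rooted_edge_labelings_isomorphic_refl[of H g1 g2 v] by auto
  then have k: "1 \<le> k" using g1 by (fastforce simp: rooted_distinguishing_edge_labeling_def)
  \<comment> \<open>The default value 1 labels the central edge, which every automorphism maps to
    itself.\<close>
  define g where "g e = (if e \<in> edges H then g2 e else if e \<in> edges K then g1 (f' ` e) else 1)" for e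
  have disj: "e \<notin> edges H" if e: "e \<in> edges K" for e
  proof -
    obtain x y where "e = {x, y}" using simple_graph_edgeE[OF other.simple_half e] by metis
    then show ?thesis using e half_disjoint by (auto simp: half_edges other.half_edges)
  qed
  have gH: "g e = g2 e" if "e \<in> edges H" for e using that by (simp add: g_def)
  have gK: "g e = g1 (f' ` e)" if "e \<in> edges K" for e using that disj by (simp add: g_def)
  have K: "rooted_distinguishing_edge_labeling K w k (\<lambda>e. g1 (f' ` e))"
    using rooted_edge_labeling_transport[OF g1 f' other.half_root other.simple_half simple_half] .
  have "distinguishing_edge_labeling G k g"
    unfolding distinguishing_edge_labeling_def
  proof (intro conjI allI impI ballI)
    show "g ` edges G \<subseteq> {1..k}"
      using k g2 K by (auto simp: g_def rooted_distinguishing_edge_labeling_def image_subset_iff)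
    fix \<alpha> x
    assume \<alpha>: "graph_aut G \<alpha> \<and> (\<forall>e\<in>edges G. g (\<alpha> ` e) = g e)" and x: "x \<in> vertices G"
    have eH: "e \<in> edges G" if "e \<in> edges H" for e using that by (simp add: half_edges)
    have eK: "e \<in> edges G" if "e \<in> edges K" for e using that by (simp add: other.half_edges)
    from conjunct1[OF \<alpha>] show "\<alpha> x = x"
    proof (cases rule: aut_cases)
      case 1
      note r = rooted_aut_half[OF conjunct1[OF \<alpha>] 1]
      have "g2 (\<alpha> ` e) = g2 e" if "e \<in> edges H" for e
        using \<alpha> eH[OF that] gH[OF that] gH[OF graph_iso_edge[OF rooted_autD(1)[OF r(1)] simple_half that]]
        by simp
      then have "\<forall>x\<in>vertices H. \<alpha> x = x"
        using g2 r(1) by (simp add: rooted_distinguishing_edge_labeling_def)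
      moreover have "g1 (f' ` \<alpha> ` e) = g1 (f' ` e)" if "e \<in> edges K" for e
        using \<alpha> eK[OF that] gK[OF that]
          gK[OF graph_iso_edge[OF rooted_autD(1)[OF r(2)] other.simple_half that]]
        by simp
      then have "\<forall>x\<in>vertices K. \<alpha> x = x"
        using K r(2) by (simp add: rooted_distinguishing_edge_labeling_def)
      ultimately show ?thesis using x half_union by auto
    next
      case 2
      have iso: "graph_iso H K \<alpha>"
        using aut_half_iso[OF tree_edge_axioms conjunct1[OF \<alpha>]] 2 by simp
      \<comment> \<open>Following the swap by \<open>f'\<close> leads back to the half at
        \<open>v\<close>, and this composite carries \<open>g1\<close> to \<open>g2\<close>.\<close>
      have "rooted_aut H v (\<lambda>x. f' (\<alpha> x))"
        using graph_iso_comp[OF iso f'(1)] f'(2) 2 by (auto intro: rooted_autI)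
      moreover have "g2 e = g1 ((\<lambda>x. f' (\<alpha> x)) ` e)" if "e \<in> edges H" for e
        using \<alpha> eH[OF that] gH[OF that] gK[OF graph_iso_edge[OF iso simple_half that]]
        by (simp add: image_image)
      ultimately show ?thesis using ni by (auto simp: rooted_edge_labelings_isomorphic_def)
    qed
  qed
  then show ?thesis by blast
qed

text \<open>If an automorphism \<open>\<alpha>\<close> of the half identified the two restrictions,
  then \<open>f\<close> after the inverse of \<open>\<alpha>\<close> on one half, glued with
  \<open>\<alpha>\<close> after \<open>f'\<close> on the other, would be a label-preserving
  swap.\<close>

lemma half_labeling_of_edge_labeling:
  assumes g: "distinguishing_edge_labeling G k g"
  shows "rooted_distinguishing_edge_labeling H v k g"
    and "rooted_distinguishing_edge_labeling H v k (\<lambda>e. g (f ` e))"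
    and "\<not> rooted_edge_labelings_isomorphic H v g (\<lambda>e. g (f ` e))"
proof -
  show "rooted_distinguishing_edge_labeling H v k g"
    using rooted_edge_labeling_half[OF distinguishing_imp_rooted(2)[OF g]] .
  have "rooted_distinguishing_edge_labeling K w k g"
    using other.rooted_edge_labeling_half[OF distinguishing_imp_rooted(2)[OF g]] .
  then show "rooted_distinguishing_edge_labeling H v k (\<lambda>e. g (f ` e))"
    using rooted_edge_labeling_transport[OF _ f half_root simple_half other.simple_half] by blast
  show "\<not> rooted_edge_labelings_isomorphic H v g (\<lambda>e. g (f ` e))"
  proof
    assume "rooted_edge_labelings_isomorphic H v g (\<lambda>e. g (f ` e))"
    then obtain \<alpha> where \<alpha>: "rooted_aut H v \<alpha>" "\<And>e. e \<in> edges H \<Longrightarrow> g (f ` e) = g (\<alpha> ` e)"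
      by (auto simp: rooted_edge_labelings_isomorphic_def)
    obtain h where h: "graph_iso H H h" "\<And>x. x \<in> vertices H \<Longrightarrow> h (\<alpha> x) = x"
      "\<And>x. x \<in> vertices H \<Longrightarrow> \<alpha> (h x) = x"
      using graph_iso_inv[OF rooted_autD(1)[OF \<alpha>(1)]] by metis
    have hv: "f (h v) = w" using h(2)[OF half_root] rooted_autD(2)[OF \<alpha>(1)] f(2) by simp
    have aw: "\<alpha> (f' w) = v" using f'(2) rooted_autD(2)[OF \<alpha>(1)] by simp
    let ?s = "\<lambda>x. if x \<in> vertices H then f (h x) else \<alpha> (f' x)"
    have aut: "graph_aut G ?s"
      by (rule glue[OF tree_edge_axioms swap graph_iso_comp[OF h(1) f(1)] hv
            graph_iso_comp[OF f'(1) rooted_autD(1)[OF \<alpha>(1)]] aw])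
    note gi = glue_image[OF tree_edge_axioms, of "\<lambda>x. f (h x)" w "\<lambda>x. \<alpha> (f' x)" v, OF hv aw]
    have "g (?s ` e) = g e" if "e \<in> edges G" for e
      using half_edges_cases[OF that]
    proof (elim disjE)
      assume e: "e \<in> edges H"
      have "g (f ` h ` e) = g (\<alpha> ` h ` e)" using \<alpha>(2)[OF graph_iso_edge[OF h(1) simple_half e]] .
      also have "\<alpha> ` h ` e = e" using graph_iso_image_cancel[of H \<alpha> h, OF simple_half h(3) e] .
      finally show ?thesis unfolding gi(1)[OF e] by (simp add: image_image)
    next
      assume e: "e \<in> edges K"
      have "g (\<alpha> ` f' ` e) = g (f ` f' ` e)"
        using \<alpha>(2)[OF graph_iso_edge[OF f'(1) other.simple_half e]] by simp
      also have "f ` f' ` e = e" using graph_iso_image_cancel[of K f f', OF other.simple_half ff' e] .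
      finally show ?thesis unfolding gi(2)[OF e] by (simp add: image_image)
    next
      assume e: "e = {v, w}"
      show ?thesis unfolding e gi(3) by (simp add: insert_commute)
    qed
    then have "?s v = v" using distinguishing_edge_labelingD[OF g aut _ adjD(1)[OF vw]] by blast
    then show False using half_root hv v_neq_w by simp
  qed
qed

text \<open>The same edge labeling serves for both halves, and the root labels 1 and 2 rule out the
  swap.\<close>

lemma vertex_labeling_of_half_labeling:
  assumes g: "rooted_distinguishing_edge_labeling H v k g" and k: "2 \<le> k"
  shows "\<exists>\<phi>. distinguishing_vertex_labeling G k \<phi>"
proof -
  interpret R: rooted_tree H v
    using finite_tree_half half_root by unfold_locales
  obtain \<phi>1 \<phi>2 where \<phi>1: "rooted_distinguishing_vertex_labeling H v k \<phi>1" "\<phi>1 v = 1"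
    and \<phi>2: "rooted_distinguishing_vertex_labeling H v k \<phi>2" "\<phi>2 v = 2"
    using R.rooted_edge_imp_vertex_labeling[OF g, of 1] R.rooted_edge_imp_vertex_labeling[OF g, of 2] k
    by fastforce
  have K: "rooted_distinguishing_vertex_labeling K w k (\<lambda>x. \<phi>2 (f' x))"
    using rooted_vertex_labeling_transport[OF \<phi>2(1) f' other.half_root] .
  define \<phi> where "\<phi> x = (if x \<in> vertices H then \<phi>1 x else \<phi>2 (f' x))" for x
  have \<phi>H: "\<phi> x = \<phi>1 x" if "x \<in> vertices H" for x using that by (simp add: \<phi>_def)
  have \<phi>K: "\<phi> x = \<phi>2 (f' x)" if "x \<in> vertices K" for x using that half_disjoint by (auto simp: \<phi>_def)
  have "distinguishing_vertex_labeling G k \<phi>"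
    unfolding distinguishing_vertex_labeling_def
  proof (intro conjI allI impI ballI)
    show "\<phi> ` vertices G \<subseteq> {1..k}"
      using \<phi>1(1) K \<phi>H \<phi>K unfolding half_union[symmetric]
      by (simp add: rooted_distinguishing_vertex_labeling_def image_subset_iff ball_Un)
    fix \<alpha> x
    assume \<alpha>: "graph_aut G \<alpha> \<and> (\<forall>x\<in>vertices G. \<phi> (\<alpha> x) = \<phi> x)" and x: "x \<in> vertices G"
    from conjunct1[OF \<alpha>] show "\<alpha> x = x"
    proof (cases rule: aut_cases)
      case 1
      note r = rooted_aut_half[OF conjunct1[OF \<alpha>] 1]
      have "\<phi>1 (\<alpha> x) = \<phi>1 x" if "x \<in> vertices H" for x
        using \<alpha> \<phi>H[OF that] \<phi>H[OF graph_isoD(2)[OF rooted_autD(1)[OF r(1)] that]] half_vertex[OF that]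
        by simp
      then have "\<forall>x\<in>vertices H. \<alpha> x = x"
        using \<phi>1(1) r(1) by (simp add: rooted_distinguishing_vertex_labeling_def)
      moreover have "\<phi>2 (f' (\<alpha> x)) = \<phi>2 (f' x)" if "x \<in> vertices K" for x
        using \<alpha> \<phi>K[OF that] \<phi>K[OF graph_isoD(2)[OF rooted_autD(1)[OF r(2)] that]]
          other.half_vertex[OF that]
        by simp
      then have "\<forall>x\<in>vertices K. \<alpha> x = x"
        using K r(2) by (simp add: rooted_distinguishing_vertex_labeling_def)
      ultimately show ?thesis using x half_union by auto
    next
      case 2
      have "\<phi> w = \<phi> v" using \<alpha> 2(1) adjD(1)[OF vw] by metis
      then show ?thesis
        using \<phi>H[OF half_root] \<phi>K[OF other.half_root] \<phi>1(2) \<phi>2(2) f'(2) by simp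
    qed
  qed
  then show ?thesis by blast
qed

text \<open>The swap built from \<open>f\<close> and \<open>f'\<close> preserves a constant
  labeling, so one label is not enough. The labeling of the half arises by restriction and by moving
  labels to parent edges.\<close>

lemma half_labeling_of_vertex_labeling:
  assumes \<phi>: "distinguishing_vertex_labeling G k \<phi>"
  shows "2 \<le> k" "\<exists>g. rooted_distinguishing_edge_labeling H v k g"
proof -
  let ?s = "\<lambda>x. if x \<in> vertices H then f x else f' x"
  have aut: "graph_aut G ?s"
    by (rule glue[OF tree_edge_axioms swap f f'])
  have sv: "?s v \<noteq> v" using half_root f(2) v_neq_w by simp
  have v: "v \<in> vertices G" using adjD(1)[OF vw] .
  have one: "\<phi> x \<in> {1..k}" if "x \<in> vertices G" for x
    using \<phi> that by (auto simp: distinguishing_vertex_labeling_def)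
  show "2 \<le> k"
  proof (rule ccontr)
    assume "\<not> 2 \<le> k"
    then have "\<phi> x = 1" if "x \<in> vertices G" for x using one[OF that] by auto
    then have "\<phi> (?s x) = \<phi> x" if "x \<in> vertices G" for x
      using graph_isoD(2)[of G G ?s x] aut that unfolding graph_aut_def by simp
    then show False
      using distinguishing_vertex_labelingD[OF \<phi> aut _ v] sv by blast
  qed
  interpret R: rooted_tree H v
    using finite_tree_half half_root by unfold_locales
  show "\<exists>g. rooted_distinguishing_edge_labeling H v k g"
    using R.rooted_vertex_imp_edge_labeling
      rooted_vertex_labeling_half[OF distinguishing_imp_rooted(1)[OF \<phi>]] by blast
qed

section \<open>Comparison of the distinguishing index with the distinguishing number\<close>

lemma distinguishing_number_labeling:
  "\<exists>\<phi>. distinguishing_vertex_labeling G (distinguishing_number G) \<phi>"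
  unfolding distinguishing_number_def by (rule LeastI_ex[OF distinguishing_vertex_labeling_exists])

text \<open>Restricting \<open>g\<close> to a half gives a labeling that, together with two
  available root labels, yields a vertex labeling of the whole tree.\<close>

lemma distinguishing_number_le:
  assumes g: "distinguishing_edge_labeling G k g"
  shows "distinguishing_number G \<le> k"
proof -
  note D = half_labeling_of_edge_labeling[OF g]
  have "2 \<le> k"
  proof (rule ccontr)
    assume "\<not> 2 \<le> k"
    \<comment> \<open>With at most one label the labelings of the two halves agree, hence would be
      isomorphic.\<close>
    have "g e = g (f ` e)" if e: "e \<in> edges H" for e
    proof -
      have "g e \<in> {1..k}" "g (f ` e) \<in> {1..k}"
        using D(1,2) e by (auto simp: rooted_distinguishing_edge_labeling_def)
      then show ?thesis using \<open>\<not> 2 \<le> k\<close> by simp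
    qed
    then show False
      using D(3) rooted_edge_labelings_isomorphic_refl[of H g "\<lambda>e. g (f ` e)" v] by blast
  qed
  then show ?thesis
    unfolding distinguishing_number_def
    using vertex_labeling_of_half_labeling[OF D(1)] by (intro Least_le) simp
qed

text \<open>A half without edges is a single vertex, and so is the other half, which leaves only two
  vertices.\<close>

lemma half_edges_nonempty:
  assumes "3 \<le> card (vertices G)"
  shows "edges H \<noteq> {}"
proof
  assume "edges H = {}"
  interpret R: rooted_tree H v
    using finite_tree_half half_root by unfold_locales
  have "x = v" if "x \<in> vertices H" for x
    using R.parent_edge[OF that] \<open>edges H = {}\<close> by auto
  then have HK: "vertices H = {v}" using half_root by auto
  then have "vertices K = {w}"
    using graph_isoD(1)[OF f(1)] f(2) by (simp add: bij_betw_def)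
  then have "vertices G = {v, w}" using half_union HK by auto
  then show False using assms v_neq_w by simp
qed

text \<open>One extra label provides a second class of labelings of the half. With exactly
  \<open>distinguishing_number G\<close> labels there is only one class, and fewer are excluded by
  \<open>distinguishing_number_le\<close>.\<close>

lemma distinguishing_index_unique:
  assumes "3 \<le> card (vertices G)"
    and "unique_rooted_distinguishing_edge_labeling H v (distinguishing_number G)"
  shows "distinguishing_index G = distinguishing_number G + 1"
  unfolding distinguishing_index_def
proof (rule Least_equality)
  let ?D = "distinguishing_number G"
  obtain g where g: "rooted_distinguishing_edge_labeling H v ?D g"
    and uniq: "\<And>g'. rooted_distinguishing_edge_labeling H v ?D g' \<Longrightarrow>
      rooted_edge_labelings_isomorphic H v g g'"
    using assms(2) by (auto simp: unique_rooted_distinguishing_edge_labeling_def)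
  have gD: "g e \<in> {1..?D}" if "e \<in> edges H" for e
    using g that by (auto simp: rooted_distinguishing_edge_labeling_def)
  obtain e0 where e0: "e0 \<in> edges H" using half_edges_nonempty[OF assms(1)] by auto
  \<comment> \<open>Renaming the label of \<open>e0\<close> to the fresh one keeps the partition of
    the edges, so \<open>g'\<close> still distinguishes. It takes a value that \<open>g\<close>
    never takes, so it is not isomorphic to \<open>g\<close>.\<close>
  define g' where "g' e = (if g e = g e0 then ?D + 1 else g e)" for e
  have edge: "\<alpha> ` e \<in> edges H" if "rooted_aut H v \<alpha>" "e \<in> edges H" for \<alpha> e
    using graph_iso_edge[OF rooted_autD(1)[OF that(1)] simple_half that(2)] .
  have g'g: "g' e = g' e' \<longleftrightarrow> g e = g e'" if "e \<in> edges H" "e' \<in> edges H" for e e'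
    using gD[OF that(1)] gD[OF that(2)] by (auto simp: g'_def)
  have "g' ` edges H \<subseteq> {1..?D + 1}" using gD by (fastforce simp: g'_def)
  then have "rooted_distinguishing_edge_labeling H v (?D + 1) g'"
    using g g'g edge by (auto simp: rooted_distinguishing_edge_labeling_def)
  moreover have "rooted_distinguishing_edge_labeling H v (?D + 1) g"
    using g by (fastforce simp: rooted_distinguishing_edge_labeling_def)
  moreover have "\<not> rooted_edge_labelings_isomorphic H v g g'"
  proof
    assume "rooted_edge_labelings_isomorphic H v g g'"
    then obtain \<alpha> where \<alpha>: "rooted_aut H v \<alpha>" "g' e0 = g (\<alpha> ` e0)"
      using e0 by (auto simp: rooted_edge_labelings_isomorphic_def)
    then show False using gD[OF edge[OF \<alpha>(1) e0]] by (simp add: g'_def)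
  qed
  ultimately show "\<exists>g. distinguishing_edge_labeling G (?D + 1) g"
    using edge_labeling_of_half_labelings by blast
  fix k assume "\<exists>g. distinguishing_edge_labeling G k g"
  then obtain h where h: "distinguishing_edge_labeling G k h" ..
  \<comment> \<open>Otherwise both half labelings coming from \<open>h\<close> would be isomorphic
    to \<open>g\<close> and hence to each other.\<close>
  have "k \<noteq> ?D"
    using half_labeling_of_edge_labeling[OF h] uniq half_root simple_half
      rooted_edge_labelings_isomorphic_cancel by metis
  then show "?D + 1 \<le> k" using distinguishing_number_le[OF h] by simp
qed

text \<open>A vertex labeling of the tree supplies one labeling of the half, and the failure of
  uniqueness a second, non-isomorphic one.\<close>

lemma distinguishing_index_not_unique:
  assumes "\<not> unique_rooted_distinguishing_edge_labeling H v (distinguishing_number G)"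
  shows "distinguishing_index G = distinguishing_number G"
  unfolding distinguishing_index_def
proof (rule Least_equality)
  obtain g where g: "rooted_distinguishing_edge_labeling H v (distinguishing_number G) g"
    using distinguishing_number_labeling half_labeling_of_vertex_labeling(2) by blast
  then show "\<exists>g. distinguishing_edge_labeling G (distinguishing_number G) g"
    using assms edge_labeling_of_half_labelings
    unfolding unique_rooted_distinguishing_edge_labeling_def by blast
qed (use distinguishing_number_le in blast)

end

section \<open>Trees with a fixed vertex, and the case distinction on the center\<close>

lemma (in rooted_tree) distinguishing_index_if_root_fixed:
  assumes "\<And>\<alpha>. graph_aut G \<alpha> \<Longrightarrow> \<alpha> r = r" "2 \<le> card (vertices G)"
  shows "distinguishing_index G = distinguishing_number G"
proof -
  have "\<not> vertices G \<subseteq> {r}" using assms(2) card_mono[of "{r}" "vertices G"] by auto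
  then obtain x where "x \<in> vertices G" "x \<noteq> r" by auto
  then have "edges G \<noteq> {}" using parent_edge by auto
  then show ?thesis
    unfolding distinguishing_index_def distinguishing_number_def
    using labelings_iff_if_root_fixed assms(1) by simp
qed

theorem theorem1:
  fixes T :: "'a ugraph"
  assumes "finite_tree T"
    and "card (vertices T) \<ge> 3"
  shows "(T \<in> exceptional_trees \<longrightarrow> distinguishing_index T = distinguishing_number T + 1)
       \<and> (T \<notin> exceptional_trees \<longrightarrow> distinguishing_index T = distinguishing_number T)"
proof -
  interpret tree T by unfold_locales (rule assms)
  have fixed: "distinguishing_index T = distinguishing_number T"
    if "c \<in> vertices T" "\<And>\<alpha>. graph_aut T \<alpha> \<Longrightarrow> \<alpha> c = c" for c
  proof -
    interpret rooted_tree T c by unfold_locales (rule that)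
    show ?thesis using distinguishing_index_if_root_fixed that(2) assms(2) by simp
  qed
  show ?thesis
  proof (intro conjI impI)
    assume "T \<in> exceptional_trees"
    then obtain v w f where bi: "bicentric_with T v w"
      and f: "graph_iso (half_tree T v w) (half_tree T w v) f" "f v = w"
      and u: "unique_rooted_distinguishing_edge_labeling (half_tree T v w) v (distinguishing_number T)"
      unfolding exceptional_trees_def rooted_isomorphic_def by blast
    interpret symmetric_tree T v w f
      by unfold_locales (use bicentric_withD[OF bi] f in auto)
    show "distinguishing_index T = distinguishing_number T + 1"
      using distinguishing_index_unique[OF assms(2) u] .
  next
    assume T: "T \<notin> exceptional_trees"
    show "distinguishing_index T = distinguishing_number T"
    proof (cases rule: central_cases)
      case (1 c)
      then show ?thesis using fixed[of c] central_aut by (auto simp: central_def)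
    next
      case (2 v w)
      interpret E: tree_edge T v w by unfold_locales (rule 2)
      show ?thesis
      proof (cases "rooted_isomorphic (half_tree T v w) v (half_tree T w v) w")
        case True
        then obtain f where f: "graph_iso (half_tree T v w) (half_tree T w v) f" "f v = w"
          by (auto simp: rooted_isomorphic_def)
        interpret symmetric_tree T v w f
          by unfold_locales (use 2 f in auto)
        show ?thesis
          using T True assms bicentric_withI[OF 2]
          by (intro distinguishing_index_not_unique) (auto simp: exceptional_trees_def)
      next
        case False
        \<comment> \<open>An automorphism moving \<open>v\<close> would swap the central vertices
          and restrict to a rooted isomorphism of the halves. Hence \<open>v\<close> is a fixed
          vertex although the tree is bicentric.\<close>
        have "\<alpha> v = v" if \<alpha>: "graph_aut T \<alpha>" for \<alpha>
        proof (rule ccontr)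
          assume "\<alpha> v \<noteq> v"
          then have "\<alpha> v = w" using central_aut[OF \<alpha>, of v] 2(1) by auto
          moreover from this have "\<alpha> w = v"
            using central_aut[OF \<alpha>, of w] 2 \<alpha> graph_isoD(4)[of T T \<alpha> v w] adjD[OF 2(2)]
            by (auto simp: graph_aut_def)
          ultimately show False
            using aut_half_iso[OF E.tree_edge_axioms \<alpha>] False by (auto simp: rooted_isomorphic_def)
        qed
        then show ?thesis using fixed[of v] adjD(1)[OF 2(2)] by blast
      qed
    qed
  qed
qed

end
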